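(* Let $\mathbb{X}$ be a reflexive, smooth real Banach space. Let $\mathcal{F}$ be the class of all norm one smooth operators in $\mathbb{K}(\mathbb{X},\mathbb{X})$. Then the pair $(\mathbb{X},\mathbb{X})$ does not have the uniform sBPBp with respect to $\mathcal{F}$.
   Context: $\mathbb{K}(\mathbb{X},\mathbb{X})$ is the space of compact linear operators on $\mathbb{X}$ with the operator norm; $S_Z$ is the unit sphere of a normed space $Z$. A non-zero element $z$ of a normed space $Z$ is smooth if there is exactly one $f\in S_{Z^*}$ with $f(z)=\|z\|$; a Banach space is smooth if each of its non-zero vectors is smooth. A smooth operator in $\mathbb{K}(\mathbb{X},\mathbb{X})$ is a smooth element of the normed space $\mathbb{K}(\mathbb{X},\mathbb{X})$. For a bounded operator $T$ on $\mathbb{X}$, $M_T=\{x\in S_{\mathbb{X}}:\|Tx\|=\|T\|\}$. For a family $\mathcal{F}$ of norm one bounded linear operators from a Banach space $\mathbb{X}$ to a Banach space $\mathbb{Y}$, the pair $(\mathbb{X},\mathbb{Y})$ has uniform sBPBp with respect to $\mathcal{F}$ if given $\epsilon>0$ there exists $\eta(\epsilon)>0$ such that whenever $T\in\mathcal{F}$ and $x_0\in S_{\mathbb{X}}$ satisfy $\|Tx_0\|>1-\eta(\epsilon)$, there exists $x_1\in M_T$ with $\|x_1-x_0\|<\epsilon$.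
   Formalization: The space X is additionally assumed to have dimension at least 2; in dimension 0 the class F is empty and in dimension 1 it is {id, −id} with M_T the whole unit sphere, so the uniform sBPBp holds and the claim fails there. *)

theory Defs
  imports "HOL-Analysis.Analysis"
begin

definition compact_operator ::
  "('a::real_normed_vector \<Rightarrow>\<^sub>L 'b::real_normed_vector) \<Rightarrow> bool" where
  "compact_operator T \<longleftrightarrow> compact (closure (blinfun_apply T ` cball 0 1))"

lemma compact_operator_zero: "compact_operator 0"
proof -
  have "blinfun_apply (0 :: 'a \<Rightarrow>\<^sub>L 'b) ` cball 0 1 = {0}"
    by (simp add: image_constant_conv)
  then show ?thesis by (simp add: compact_operator_def)
qed

lemma compact_operator_add:
  assumes "compact_operator S" "compact_operator T"
  shows "compact_operator (S + T)"
proof -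
  let ?A = "closure (blinfun_apply S ` cball 0 1)"
  let ?B = "closure (blinfun_apply T ` cball 0 1)"
  let ?K = "{x + y | x y. x \<in> ?A \<and> y \<in> ?B}"
  have K: "compact ?K"
    using assms by (intro compact_sums) (auto simp: compact_operator_def)
  have "blinfun_apply (S + T) ` cball 0 1 \<subseteq> ?K"
  proof (rule image_subsetI)
    fix u :: 'a
    assume "u \<in> cball 0 1"
    then have "blinfun_apply S u \<in> ?A" "blinfun_apply T u \<in> ?B"
      by (auto intro!: subsetD[OF closure_subset] imageI)
    then show "blinfun_apply (S + T) u \<in> ?K"
      by (intro CollectI exI conjI) (rule blinfun.add_left)
  qed
  then have "closure (blinfun_apply (S + T) ` cball 0 1) \<subseteq> ?K"
    by (rule closure_minimal) (rule compact_imp_closed[OF K])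
  then show ?thesis
    using compact_Int_closed[OF K closed_closure, of "blinfun_apply (S + T) ` cball 0 1"]
    unfolding compact_operator_def by (simp only: Int_absorb1)
qed

lemma compact_operator_scaleR:
  assumes "compact_operator T"
  shows "compact_operator (c *\<^sub>R T)"
proof -
  have "blinfun_apply (c *\<^sub>R T) ` cball 0 1 = (\<lambda>x. c *\<^sub>R x) ` (blinfun_apply T ` cball 0 1)"
    by (auto simp: image_image blinfun.scaleR_left)
  then have "closure (blinfun_apply (c *\<^sub>R T) ` cball 0 1)
      = (\<lambda>x. c *\<^sub>R x) ` closure (blinfun_apply T ` cball 0 1)"
    by (simp only: closure_scaleR)
  then show ?thesis
    using compact_scaling[of _ c] assms unfolding compact_operator_def by metis
qed

lemma compact_operator_uminus: "compact_operator T \<Longrightarrow> compact_operator (- T)"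
  using compact_operator_scaleR[of T "- 1"] by (simp only: scaleR_minus1_left)

lemma compact_operator_diff:
  "compact_operator S \<Longrightarrow> compact_operator T \<Longrightarrow> compact_operator (S - T)"
  using compact_operator_add[of S "- T"] compact_operator_uminus[of T]
  by (simp only: add_uminus_conv_diff)

text \<open>The space \<open>\<K>(X, Y)\<close> is a normed space in its own right, so that its dual consists of the
  functionals on compact operators only, not on all bounded operators.\<close>

typedef (overloaded) ('a::real_normed_vector, 'b::real_normed_vector) compact_op =
  "{T :: 'a \<Rightarrow>\<^sub>L 'b. compact_operator T}"
  morphisms blinfun_of_compact Compact_op
  using compact_operator_zero by blast

instantiation compact_op :: (real_normed_vector, real_normed_vector) real_normed_vector
begin

definition norm_compact_op :: "('a, 'b) compact_op \<Rightarrow> real" where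
  "norm_compact_op T = norm (blinfun_of_compact T)"

definition zero_compact_op :: "('a, 'b) compact_op" where
  "zero_compact_op = Compact_op 0"

definition plus_compact_op ::
  "('a, 'b) compact_op \<Rightarrow> ('a, 'b) compact_op \<Rightarrow> ('a, 'b) compact_op" where
  "plus_compact_op S T = Compact_op (blinfun_of_compact S + blinfun_of_compact T)"

definition minus_compact_op ::
  "('a, 'b) compact_op \<Rightarrow> ('a, 'b) compact_op \<Rightarrow> ('a, 'b) compact_op" where
  "minus_compact_op S T = Compact_op (blinfun_of_compact S - blinfun_of_compact T)"

definition uminus_compact_op :: "('a, 'b) compact_op \<Rightarrow> ('a, 'b) compact_op" where
  "uminus_compact_op T = Compact_op (- blinfun_of_compact T)"

definition scaleR_compact_op :: "real \<Rightarrow> ('a, 'b) compact_op \<Rightarrow> ('a, 'b) compact_op" where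
  "scaleR_compact_op c T = Compact_op (c *\<^sub>R blinfun_of_compact T)"

definition dist_compact_op :: "('a, 'b) compact_op \<Rightarrow> ('a, 'b) compact_op \<Rightarrow> real" where
  "dist_compact_op S T = norm (S - T)"

definition uniformity_compact_op ::
  "(('a, 'b) compact_op \<times> ('a, 'b) compact_op) filter" where
  "uniformity_compact_op = (INF e\<in>{0 <..}. principal {(x, y). dist x y < e})"

definition open_compact_op :: "('a, 'b) compact_op set \<Rightarrow> bool" where
  "open_compact_op U = (\<forall>x\<in>U. \<forall>\<^sub>F (x', y) in uniformity. x' = x \<longrightarrow> y \<in> U)"

definition sgn_compact_op :: "('a, 'b) compact_op \<Rightarrow> ('a, 'b) compact_op" where
  "sgn_compact_op T = inverse (norm T) *\<^sub>R T"

lemma compact_operator_blinfun_of_compact: "compact_operator (blinfun_of_compact T)"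
  using blinfun_of_compact[of T] by simp

lemma blinfun_of_compact_zero: "blinfun_of_compact 0 = 0"
  unfolding zero_compact_op_def by (simp add: Compact_op_inverse compact_operator_zero)

lemma blinfun_of_compact_add:
  "blinfun_of_compact (S + T) = blinfun_of_compact S + blinfun_of_compact T"
  unfolding plus_compact_op_def
  by (simp add: Compact_op_inverse compact_operator_add compact_operator_blinfun_of_compact)

lemma blinfun_of_compact_diff:
  "blinfun_of_compact (S - T) = blinfun_of_compact S - blinfun_of_compact T"
  unfolding minus_compact_op_def
  by (simp add: Compact_op_inverse compact_operator_diff compact_operator_blinfun_of_compact)

lemma blinfun_of_compact_uminus: "blinfun_of_compact (- T) = - blinfun_of_compact T"
  unfolding uminus_compact_op_def
  by (simp add: Compact_op_inverse compact_operator_uminus compact_operator_blinfun_of_compact)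

lemma blinfun_of_compact_scaleR: "blinfun_of_compact (c *\<^sub>R T) = c *\<^sub>R blinfun_of_compact T"
  unfolding scaleR_compact_op_def
  by (simp add: Compact_op_inverse compact_operator_scaleR compact_operator_blinfun_of_compact)

lemmas blinfun_of_compact_simps =
  blinfun_of_compact_zero blinfun_of_compact_add blinfun_of_compact_diff
  blinfun_of_compact_uminus blinfun_of_compact_scaleR

instance
proof
  fix S T U :: "('a, 'b) compact_op" and a b :: real and V :: "('a, 'b) compact_op set"
  note eq = blinfun_of_compact_inject[symmetric] blinfun_of_compact_simps
  show "S + T + U = S + (T + U)" "S + T = T + S" "0 + T = T" "- T + T = 0" "S - T = S + - T"
    by (simp_all add: eq)
  show "a *\<^sub>R (S + T) = a *\<^sub>R S + a *\<^sub>R T" "(a + b) *\<^sub>R T = a *\<^sub>R T + b *\<^sub>R T"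
    "a *\<^sub>R b *\<^sub>R T = (a * b) *\<^sub>R T" "1 *\<^sub>R T = T"
    by (simp_all add: eq scaleR_add_right scaleR_add_left)
  show "norm T = 0 \<longleftrightarrow> T = 0" "norm (S + T) \<le> norm S + norm T" "norm (a *\<^sub>R T) = \<bar>a\<bar> * norm T"
    by (simp_all add: eq norm_compact_op_def norm_triangle_ineq)
  show "dist S T = norm (S - T)" "sgn T = inverse (norm T) *\<^sub>R T"
    "(uniformity :: (('a, 'b) compact_op \<times> ('a, 'b) compact_op) filter)
      = (INF e\<in>{0<..}. principal {(x, y). dist x y < e})"
    "open V = (\<forall>x\<in>V. \<forall>\<^sub>F (x', y) in uniformity. x' = x \<longrightarrow> y \<in> V)"
    by (rule dist_compact_op_def sgn_compact_op_def uniformity_compact_op_def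
        open_compact_op_def)+
qed

end

definition smooth_point :: "'z::real_normed_vector \<Rightarrow> bool" where
  "smooth_point z \<longleftrightarrow> z \<noteq> 0 \<and> (\<exists>!f :: 'z \<Rightarrow>\<^sub>L real. norm f = 1 \<and> blinfun_apply f z = norm z)"

definition smooth_space :: "'z::real_normed_vector itself \<Rightarrow> bool" where
  "smooth_space _ \<longleftrightarrow> (\<forall>z::'z. z \<noteq> 0 \<longrightarrow> smooth_point z)"

definition reflexive_space :: "'z::real_normed_vector itself \<Rightarrow> bool" where
  "reflexive_space _ \<longleftrightarrow>
    (\<forall>\<phi> :: ('z \<Rightarrow>\<^sub>L real) \<Rightarrow>\<^sub>L real. \<exists>x::'z. \<forall>f. blinfun_apply \<phi> f = blinfun_apply f x)"

definition norm_attainment_set ::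
  "('a::real_normed_vector \<Rightarrow>\<^sub>L 'b::real_normed_vector) \<Rightarrow> 'a set" where
  "norm_attainment_set T = {x \<in> sphere 0 1. norm (blinfun_apply T x) = norm T}"

text \<open>The notion is meant for families \<open>F\<close> of norm one operators; the definition itself does not
  impose this on \<open>F\<close>.\<close>

definition uniform_sBPBp ::
  "('a::real_normed_vector \<Rightarrow>\<^sub>L 'b::real_normed_vector) set \<Rightarrow> bool" where
  "uniform_sBPBp F \<longleftrightarrow>
    (\<forall>\<epsilon>>0. \<exists>\<eta>>0. \<forall>T\<in>F. \<forall>x0\<in>sphere 0 1. norm (blinfun_apply T x0) > 1 - \<eta> \<longrightarrow>
      (\<exists>x1\<in>norm_attainment_set T. norm (x1 - x0) < \<epsilon>))"

definition norm_one_smooth_compact_operators ::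
  "('a::real_normed_vector \<Rightarrow>\<^sub>L 'b::real_normed_vector) set" where
  "norm_one_smooth_compact_operators =
    {blinfun_of_compact T | T :: ('a, 'b) compact_op. norm T = 1 \<and> smooth_point T}"

end

theory Submission
  imports Defs
begin

text \<open>
  Choose biorthogonal \<open>a, b\<close> and \<open>f, g\<close>, and let \<open>T\<close> have maximal determinant among the operators
  of norm at most one that project by \<open>f, g\<close> onto the span of \<open>a, b\<close> and then act on it by a
  2 by 2 matrix. Let \<open>v\<close> be a unit vector in the closure of the image of the unit ball and \<open>h\<close> its
  support functional. Shrinking \<open>v\<close> and expanding the kernel of \<open>h\<close> twice as fast increases the
  determinant, so \<open>T\<close> must almost attain its norm also at unit vectors \<open>y\<close> for which \<open>\<bar>h (T y)\<bar>\<close>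
  stays away from \<open>1\<close>. On the other hand all maximisers \<open>x\<close> of \<open>T + \<tau> (h T) v\<close>, and of all operators
  very close to it, have \<open>\<bar>h (T x)\<bar>\<close> close to \<open>1\<close>, hence keep a fixed distance from \<open>y\<close>,
  however small \<open>\<tau>\<close> is.

  Smooth operators near \<open>T + \<tau> (h T) v\<close> come from Stegall's variational principle: an arbitrarily small
  functional \<open>f\<close> gives \<open>\<parallel>T z\<parallel> + f z\<close> a strong maximum \<open>x\<close> on the unit ball, and then \<open>T + f (T x) / \<parallel>T x\<parallel>\<close>
  attains its norm strongly at \<open>x\<close> and \<open>-x\<close> only. Strong attainment together with the smoothness of the
  range space forces smoothness of the operator.
\<close>

section \<open>The Hahn-Banach theorem\<close>

text \<open>Homogeneity is encoded as an inequality for \<open>t > 0\<close>; applying it to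
  \<open>inverse t\<close> gives equality. This form is convenient for infima, where only upper
  estimates are at hand.\<close>

definition sublinear :: "('a::real_vector \<Rightarrow> real) \<Rightarrow> bool" where
  "sublinear p \<longleftrightarrow> (\<forall>x y. p (x + y) \<le> p x + p y) \<and> (\<forall>x. \<forall>t>0. p (t *\<^sub>R x) \<le> t * p x)"

lemma sublinear_zero:
  assumes "sublinear p"
  shows "p 0 = 0"
proof -
  have "p 0 \<le> 2 * p 0" "p 0 \<le> 1/2 * p 0"
    using assms unfolding sublinear_def
    by (metis scaleR_zero_right zero_less_numeral, metis scaleR_zero_right half_gt_zero_iff zero_less_one)
  then show ?thesis by simp
qed

lemma sublinear_scaleR:
  assumes "sublinear p" "0 \<le> t"
  shows "p (t *\<^sub>R x) = t * p x"
proof (cases "t = 0")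
  case True
  then show ?thesis using sublinear_zero[OF assms(1)] by simp
next
  case False
  then have t: "0 < t" using assms by simp
  have "p (inverse t *\<^sub>R (t *\<^sub>R x)) \<le> inverse t * p (t *\<^sub>R x)"
    using assms(1) t unfolding sublinear_def by (meson positive_imp_inverse_positive)
  then have "t * p x \<le> p (t *\<^sub>R x)"
    using t by (simp add: field_simps)
  moreover have "p (t *\<^sub>R x) \<le> t * p x"
    using assms(1) t unfolding sublinear_def by blast
  ultimately show ?thesis by simp
qed

lemma sublinear_add: "sublinear p \<Longrightarrow> p (x + y) \<le> p x + p y"
  by (simp add: sublinear_def)

lemma sublinear_minus:
  assumes "sublinear p"
  shows "- p (- x) \<le> p x"
  using sublinear_add[OF assms, of x "- x"] sublinear_zero[OF assms] by simp

text \<open>Every Hahn-Banach argument below starts from a sublinear functional that is a pointwise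
  infimum: shifts, chains in Zorn's lemma, quotient seminorms, difference quotients of the norm, and
  upper limits.\<close>

lemma sublinear_Inf:
  fixes S :: "'a::real_vector \<Rightarrow> real set"
  assumes ne: "\<And>x. S x \<noteq> {}" and bdd: "\<And>x. bdd_below (S x)"
    and add: "\<And>x y a b. a \<in> S x \<Longrightarrow> b \<in> S y \<Longrightarrow> \<exists>c\<in>S (x + y). c \<le> a + b"
    and scale: "\<And>x t a. 0 < t \<Longrightarrow> a \<in> S x \<Longrightarrow> \<exists>c\<in>S (t *\<^sub>R x). c \<le> t * a"
  shows "sublinear (\<lambda>x. Inf (S x))"
  unfolding sublinear_def
proof (intro conjI allI impI)
  fix x y
  have *: "Inf (S (x + y)) \<le> a + b" if "a \<in> S x" "b \<in> S y" for a b
    using add[OF that] cInf_lower[OF _ bdd] by (meson order_trans)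
  have "Inf (S (x + y)) - a \<le> Inf (S y)" if "a \<in> S x" for a
    using *[OF that] by (intro cInf_greatest ne) (simp add: algebra_simps)
  then have "Inf (S (x + y)) - Inf (S y) \<le> Inf (S x)"
    by (intro cInf_greatest ne) (simp add: algebra_simps)
  then show "Inf (S (x + y)) \<le> Inf (S x) + Inf (S y)" by simp
next
  fix x and t :: real
  assume t: "0 < t"
  have "Inf (S (t *\<^sub>R x)) / t \<le> a" if a: "a \<in> S x" for a
  proof -
    have "Inf (S (t *\<^sub>R x)) \<le> t * a"
      using scale[OF t a] cInf_lower[OF _ bdd] by (meson order_trans)
    then show ?thesis using t by (simp add: field_simps)
  qed
  then have "Inf (S (t *\<^sub>R x)) / t \<le> Inf (S x)"
    by (intro cInf_greatest ne)
  then show "Inf (S (t *\<^sub>R x)) \<le> t * Inf (S x)"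
    using t by (simp add: field_simps)
qed

text \<open>The functional is the infimum over \<open>t \<ge> 0\<close> of
  \<open>p (x + t z) - t p z\<close>; \<open>t = 0\<close> puts it below \<open>p\<close>, and
  \<open>t = 1\<close> gives the bound at \<open>- z\<close>.\<close>

lemma sublinear_shift:
  assumes p: "sublinear p"
  shows "\<exists>q. sublinear q \<and> (\<forall>x. q x \<le> p x) \<and> q (- z) \<le> - p z"
proof -
  define S where "S x = {p (x + t *\<^sub>R z) - t * p z | t. 0 \<le> t}" for x
  have lower: "- p (- x) \<le> a" if "a \<in> S x" for a x
  proof -
    obtain t where t: "0 \<le> t" "a = p (x + t *\<^sub>R z) - t * p z"
      using \<open>a \<in> S x\<close> unfolding S_def by blast
    have "p (t *\<^sub>R z) \<le> p (x + t *\<^sub>R z) + p (- x)"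
      using sublinear_add[OF p, of "x + t *\<^sub>R z" "- x"] by simp
    then show ?thesis using t sublinear_scaleR[OF p] by simp
  qed
  have bdd: "bdd_below (S x)" for x
    using lower unfolding bdd_below_def by blast
  have memI: "p (x + t *\<^sub>R z) - t * p z \<in> S x" if "0 \<le> t" for x t
    using that unfolding S_def by blast
  have "sublinear (\<lambda>x. Inf (S x))"
  proof (rule sublinear_Inf)
    show "S x \<noteq> {}" for x using memI[of 0 x] by auto
    show "bdd_below (S x)" for x by (rule bdd)
  next
    fix x y a b assume "a \<in> S x" "b \<in> S y"
    then obtain t s where ts: "0 \<le> t" "a = p (x + t *\<^sub>R z) - t * p z"
      "0 \<le> s" "b = p (y + s *\<^sub>R z) - s * p z" unfolding S_def by blast
    have "p (x + y + (t + s) *\<^sub>R z) \<le> p (x + t *\<^sub>R z) + p (y + s *\<^sub>R z)"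
      using sublinear_add[OF p, of "x + t *\<^sub>R z" "y + s *\<^sub>R z"] by (simp add: algebra_simps)
    then show "\<exists>c\<in>S (x + y). c \<le> a + b"
      using ts by (intro bexI[OF _ memI[of "t + s"]]) (auto simp: algebra_simps)
  next
    fix x and s a :: real assume s: "0 < s" and "a \<in> S x"
    then obtain t where t: "0 \<le> t" "a = p (x + t *\<^sub>R z) - t * p z" unfolding S_def by blast
    have "p (s *\<^sub>R x + (s * t) *\<^sub>R z) = s * p (x + t *\<^sub>R z)"
      using sublinear_scaleR[OF p, of s "x + t *\<^sub>R z"] s by (simp add: algebra_simps)
    then show "\<exists>c\<in>S (s *\<^sub>R x). c \<le> s * a"
      using s t by (intro bexI[OF _ memI[of "s * t"]]) (auto simp: right_diff_distrib)
  qed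
  moreover have "Inf (S x) \<le> p x" for x
    using cInf_lower[OF memI[of 0 x] bdd] by simp
  moreover have "Inf (S (- z)) \<le> - p z"
    using cInf_lower[OF memI[of 1 "- z"] bdd] sublinear_zero[OF p] by simp
  ultimately show ?thesis by blast
qed

text \<open>Zorn's lemma for the reversed pointwise order; the lower bound of a nonempty chain is
  its pointwise infimum, bounded below by \<open>- p (- x)\<close>.\<close>

lemma sublinear_minimal:
  assumes p: "sublinear (p :: 'a::real_vector \<Rightarrow> real)"
  shows "\<exists>m. sublinear m \<and> m \<le> p \<and> (\<forall>q. sublinear q \<longrightarrow> q \<le> m \<longrightarrow> q = m)"
proof -
  let ?A = "{q. sublinear q \<and> q \<le> p}"
  have "\<exists>m\<in>?A. \<forall>a\<in>?A. m \<ge> a \<longrightarrow> a = m"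
  proof (rule predicate_Zorn)
    show "partial_order_on ?A (relation_of (\<ge>) ?A)"
      by (rule partial_order_on_relation_ofI) auto
  next
    fix C assume C: "C \<in> Chains (relation_of (\<ge>) ?A)"
    have CA: "C \<subseteq> ?A" and tot: "\<And>a b. a \<in> C \<Longrightarrow> b \<in> C \<Longrightarrow> a \<le> b \<or> b \<le> a"
      using C unfolding Chains_def relation_of_def by auto
    show "\<exists>u\<in>?A. \<forall>a\<in>C. a \<ge> u"
    proof (cases "C = {}")
      case True
      then show ?thesis using p by auto
    next
      case False
      define S where "S x = (\<lambda>q. q x) ` C" for x
      have bdd: "bdd_below (S x)" for x
      proof -
        have "- p (- x) \<le> q x" if "q \<in> C" for q
        proof -
          have "sublinear q" "q \<le> p" using that CA by auto
          then show ?thesis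
            using sublinear_minus[of q x] le_funD[of q p "- x"] by linarith
        qed
        then show ?thesis unfolding S_def bdd_below_def by blast
      qed
      have "sublinear (\<lambda>x. Inf (S x))"
      proof (rule sublinear_Inf)
        show "S x \<noteq> {}" for x using False by (simp add: S_def)
        show "bdd_below (S x)" for x by (rule bdd)
      next
        fix x y a b assume "a \<in> S x" "b \<in> S y"
        then obtain q r where qr: "q \<in> C" "r \<in> C" "a = q x" "b = r y" unfolding S_def by blast
        have "q (x + y) \<le> q x + q y" "r (x + y) \<le> r x + r y"
          using qr CA sublinear_add by blast+
        \<comment> \<open>Of two members of a chain, the smaller one serves for both
          arguments.\<close>
        moreover have "q y \<le> r y \<or> r x \<le> q x"
          using tot[OF qr(1,2)] by (auto simp: le_fun_def)
        ultimately have "q (x + y) \<le> a + b \<or> r (x + y) \<le> a + b"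
          using qr by linarith
        then show "\<exists>c\<in>S (x + y). c \<le> a + b"
          using qr unfolding S_def by blast
      next
        fix x and s a :: real assume s: "0 < s" and "a \<in> S x"
        then obtain q where q: "q \<in> C" "a = q x" unfolding S_def by blast
        then have "q (s *\<^sub>R x) \<le> s * a"
          using CA s unfolding sublinear_def by blast
        then show "\<exists>c\<in>S (s *\<^sub>R x). c \<le> s * a"
          using q unfolding S_def by blast
      qed
      moreover have lb: "(\<lambda>x. Inf (S x)) \<le> a" if "a \<in> C" for a
        using that by (auto simp: le_fun_def S_def intro!: cInf_lower bdd[unfolded S_def])
      moreover have "(\<lambda>x. Inf (S x)) \<le> p"
        using False lb CA by (metis (mono_tags, lifting) all_not_in_conv mem_Collect_eq order_trans subset_iff)
      ultimately show ?thesis by blast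
    qed
  qed
  then show ?thesis by (metis (mono_tags, lifting) mem_Collect_eq order_trans)
qed

text \<open>A minimal sublinear functional is odd, hence linear.\<close>
theorem hahn_banach_sublinear:
  fixes p :: "'a::real_vector \<Rightarrow> real"
  assumes p: "sublinear p"
  shows "\<exists>F. linear F \<and> (\<forall>x. F x \<le> p x) \<and> F z = p z"
proof -
  \<comment> \<open>Shifting by \<open>z\<close> before minimising forces
    \<open>F (- z) \<le> - p z\<close>, which for a linear \<open>F\<close> is
    \<open>p z \<le> F z\<close>.\<close>
  obtain q where q: "sublinear q" "\<forall>x. q x \<le> p x" "q (- z) \<le> - p z"
    using sublinear_shift[OF p] by blast
  obtain F where F: "sublinear F" "F \<le> q" and min: "\<And>r. sublinear r \<Longrightarrow> r \<le> F \<Longrightarrow> r = F"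
    using sublinear_minimal[OF q(1)] by blast
  have odd: "F (- x) = - F x" for x
  proof -
    obtain r where r: "sublinear r" "\<forall>x. r x \<le> F x" "r (- x) \<le> - F x"
      using sublinear_shift[OF F(1)] by blast
    then have "r = F" by (intro min) (auto simp: le_fun_def)
    then show ?thesis using r(3) sublinear_minus[OF F(1), of x] by simp
  qed
  have "linear F"
  proof (rule linearI)
    fix x y
    show "F (x + y) = F x + F y"
      using sublinear_add[OF F(1), of x y] sublinear_add[OF F(1), of "- x" "- y"]
        odd[of x] odd[of y] odd[of "x + y"] by simp
  next
    fix t :: real and x
    show "F (t *\<^sub>R x) = t *\<^sub>R F x"
    proof (cases "0 \<le> t")
      case True
      then show ?thesis using sublinear_scaleR[OF F(1)] by simp
    next
      case False
      then show ?thesis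
        using sublinear_scaleR[OF F(1), of "- t" x] odd[of "t *\<^sub>R x"] by simp
    qed
  qed
  moreover have le: "F x \<le> p x" for x
    using le_funD[OF F(2), of x] q(2)[rule_format, of x] by linarith
  moreover have "p z \<le> F z"
    using le_funD[OF F(2), of "- z"] q(3) odd[of z] by linarith
  ultimately show ?thesis
    using order_antisym by blast
qed

section \<open>Separation from subspaces and norming functionals\<close>

lemma sublinear_norm: "sublinear norm"
  by (simp add: sublinear_def norm_triangle_ineq)

text \<open>The infimum of \<open>q (x - w)\<close> over \<open>w\<close> in \<open>W\<close> is the
  quotient seminorm. A linear functional below it that touches it at \<open>z\<close> vanishes on
  \<open>W\<close> and is at least \<open>e\<close> at \<open>z\<close>.\<close>

lemma hahn_banach_subspace:
  fixes q :: "'a::real_vector \<Rightarrow> real"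
  assumes q: "sublinear q" and sym: "\<And>x. q (- x) = q x"
    and W: "subspace W" and sep: "\<And>w. w \<in> W \<Longrightarrow> e \<le> q (z - w)"
  shows "\<exists>F. linear F \<and> (\<forall>x. \<bar>F x\<bar> \<le> q x) \<and> (\<forall>w\<in>W. F w = 0) \<and> e \<le> F z"
proof -
  define S where "S x = (\<lambda>w. q (x - w)) ` W" for x
  have q0: "0 \<le> q x" for x
    using sublinear_minus[OF q, of x] sym[of x] by simp
  have W0: "0 \<in> W" by (rule subspace_0[OF W])
  have bdd: "bdd_below (S x)" for x
    using q0 unfolding S_def bdd_below_def by blast
  have sub: "sublinear (\<lambda>x. Inf (S x))"
  proof (rule sublinear_Inf)
    show "S x \<noteq> {}" for x using W0 by (auto simp: S_def)
    show "bdd_below (S x)" for x by (rule bdd)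
  next
    fix x y a b assume "a \<in> S x" "b \<in> S y"
    then obtain v w where vw: "v \<in> W" "w \<in> W" "a = q (x - v)" "b = q (y - w)"
      unfolding S_def by blast
    have "q (x + y - (v + w)) \<le> a + b"
      using sublinear_add[OF q, of "x - v" "y - w"] vw by (simp add: algebra_simps)
    then show "\<exists>c\<in>S (x + y). c \<le> a + b"
      using subspace_add[OF W vw(1,2)] unfolding S_def by blast
  next
    fix x and s a :: real assume s: "0 < s" and "a \<in> S x"
    then obtain w where w: "w \<in> W" "a = q (x - w)" unfolding S_def by blast
    have "q (s *\<^sub>R x - s *\<^sub>R w) \<le> s * a"
      using sublinear_scaleR[OF q, of s "x - w"] s w by (simp add: algebra_simps)
    then show "\<exists>c\<in>S (s *\<^sub>R x). c \<le> s * a"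
      using subspace_scale[OF W w(1)] unfolding S_def by blast
  qed
  obtain F where F: "linear F" "\<And>x. F x \<le> Inf (S x)" "F z = Inf (S z)"
    using hahn_banach_sublinear[OF sub] by blast
  have Fq: "F x \<le> q (x - w)" if "w \<in> W" for x w
    using F(2)[of x] cInf_lower[OF _ bdd, of "q (x - w)" x] that unfolding S_def by fastforce
  have "F x \<le> q x" "- F x \<le> q x" for x
    using Fq[OF W0, of x] Fq[OF W0, of "- x"] sym[of x] by (simp_all add: linear_neg[OF F(1)])
  then have "\<bar>F x\<bar> \<le> q x" for x by (simp add: abs_le_iff)
  moreover have "F w = 0" if w: "w \<in> W" for w
  proof -
    have "F w \<le> 0" "F (- w) \<le> 0"
      using Fq[OF w, of w] Fq[OF subspace_neg[OF W w], of "- w"] sublinear_zero[OF q] by simp_all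
    then show ?thesis by (simp add: linear_neg[OF F(1)])
  qed
  moreover have "e \<le> F z"
    unfolding F(3) S_def using W0 sep by (intro cINF_greatest) auto
  ultimately show ?thesis using F(1) by blast
qed

lemma linear_bounded_blinfun:
  fixes F :: "'a::real_normed_vector \<Rightarrow> real"
  assumes "linear F" and "\<And>x. \<bar>F x\<bar> \<le> M * norm x" and "0 \<le> M"
  shows "\<exists>f :: 'a \<Rightarrow>\<^sub>L real. (\<forall>x. blinfun_apply f x = F x) \<and> norm f \<le> M"
proof -
  interpret F: linear F by (rule assms(1))
  have "bounded_linear F"
    using assms(2) by (intro bounded_linear_intro[where K = M])
      (auto simp: F.add F.scaleR mult.commute)
  then have "blinfun_apply (Blinfun F) x = F x" for x
    by (simp add: bounded_linear_Blinfun_apply)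
  moreover from this have "norm (Blinfun F) \<le> M"
    using assms by (intro norm_blinfun_bound) auto
  ultimately show ?thesis by blast
qed

lemma ex_norming_functional:
  fixes z :: "'a::real_normed_vector"
  obtains f :: "'a \<Rightarrow>\<^sub>L real" where "norm f \<le> 1" "blinfun_apply f z = norm z"
proof -
  obtain F where F: "linear F" "\<And>x. F x \<le> norm x" "F z = norm z"
    using hahn_banach_sublinear[OF sublinear_norm] by blast
  have "\<bar>F x\<bar> \<le> 1 * norm x" for x
    using F(2)[of x] F(2)[of "- x"] by (simp add: linear_neg[OF F(1)] abs_le_iff)
  then obtain f :: "'a \<Rightarrow>\<^sub>L real" where "\<And>x. blinfun_apply f x = F x" "norm f \<le> 1"
    using linear_bounded_blinfun[OF F(1), of 1] by auto
  with F(3) show thesis by (intro that[of f]) simp_all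
qed

text \<open>The one-sided directional derivative of the norm is sublinear; a linear functional below it
  that touches it at \<open>d\<close> is a support functional at \<open>w\<close>, so it is \<open>h\<close>.\<close>
lemma smooth_point_norm_derivative:
  fixes w :: "'a::real_normed_vector"
  assumes w: "smooth_point w" and h: "norm (h :: 'a \<Rightarrow>\<^sub>L real) = 1" "blinfun_apply h w = norm w"
    and e: "0 < e"
  shows "\<exists>s>0. norm (w + s *\<^sub>R d) < norm w + s * (blinfun_apply h d + e)"
proof -
  define S where "S x = (\<lambda>s. (norm (w + s *\<^sub>R x) - norm w) / s) ` {0<..}" for x
  have lower: "- norm x \<le> a" if a: "a \<in> S x" for a x
  proof -
    obtain s where s: "0 < s" "a = (norm (w + s *\<^sub>R x) - norm w) / s"
      using a unfolding S_def by auto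
    have "norm w \<le> norm (w + s *\<^sub>R x) + s * norm x"
      using norm_triangle_ineq4[of "w + s *\<^sub>R x" "s *\<^sub>R x"] s by simp
    then have "s * (- norm x) \<le> s * a" using s by simp
    then show ?thesis using s(1) by (rule mult_left_le_imp_le)
  qed
  have bdd: "bdd_below (S x)" for x using lower unfolding bdd_below_def by blast
  have sub: "sublinear (\<lambda>x. Inf (S x))"
  proof (rule sublinear_Inf)
    show "S x \<noteq> {}" for x by (auto simp: S_def)
    show "bdd_below (S x)" for x by (rule bdd)
  next
    fix x y a b assume "a \<in> S x" "b \<in> S y"
    then obtain s t where st: "0 < s" "0 < t" "a = (norm (w + s *\<^sub>R x) - norm w) / s"
        "b = (norm (w + t *\<^sub>R y) - norm w) / t"
      unfolding S_def by auto
    \<comment> \<open>With this \<open>r\<close> the weights \<open>r / s\<close> and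
      \<open>r / t\<close> add up to one, so \<open>w + r (x + y)\<close> is a convex combination of
      \<open>w + s x\<close> and \<open>w + t y\<close>.\<close>
    define r where "r = s * t / (s + t)"
    have "r / s + r / t = (s + t) / (s + t)"
      unfolding r_def add_divide_distrib using st(1,2) by simp
    then have r: "0 < r" "r / s + r / t = 1"
      using st(1,2) by (auto simp: r_def)
    have "w + r *\<^sub>R (x + y) = (r / s) *\<^sub>R (w + s *\<^sub>R x) + (r / t) *\<^sub>R (w + t *\<^sub>R y)"
    proof -
      have "(r / s) *\<^sub>R (w + s *\<^sub>R x) + (r / t) *\<^sub>R (w + t *\<^sub>R y)
          = (r / s + r / t) *\<^sub>R w + r *\<^sub>R (x + y)"
        using st(1,2) by (simp add: algebra_simps)
      then show ?thesis using r(2) by simp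
    qed
    then have "norm (w + r *\<^sub>R (x + y)) \<le> r / s * norm (w + s *\<^sub>R x) + r / t * norm (w + t *\<^sub>R y)"
      using norm_triangle_ineq[of "(r / s) *\<^sub>R (w + s *\<^sub>R x)" "(r / t) *\<^sub>R (w + t *\<^sub>R y)"] r(1) st(1,2)
      by simp
    also have "\<dots> = r / s * (norm w + s * a) + r / t * (norm w + t * b)"
      using st by simp
    also have "\<dots> = r * (a + b) + (r / s + r / t) * norm w"
      using st(1,2) by (simp add: distrib_left distrib_right)
    finally have "(norm (w + r *\<^sub>R (x + y)) - norm w) / r \<le> a + b"
      using r by (simp add: field_simps)
    then show "\<exists>c\<in>S (x + y). c \<le> a + b"
      using r(1) unfolding S_def by blast
  next
    fix x and t a :: real assume t: "0 < t" and "a \<in> S x"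
    then obtain s where s: "0 < s" "a = (norm (w + s *\<^sub>R x) - norm w) / s" unfolding S_def by auto
    have "(norm (w + (s / t) *\<^sub>R (t *\<^sub>R x)) - norm w) / (s / t) = t * a"
      using s t by simp
    moreover have "s / t \<in> {0<..}" using s t by simp
    ultimately show "\<exists>c\<in>S (t *\<^sub>R x). c \<le> t * a"
      unfolding S_def by (metis (no_types, lifting) image_eqI order_refl)
  qed
  obtain F where F: "linear F" "\<And>x. F x \<le> Inf (S x)" "F d = Inf (S d)"
    using hahn_banach_sublinear[OF sub] by blast
  have F1: "F x \<le> norm (w + x) - norm w" for x
  proof -
    have "norm (w + x) - norm w \<in> S x"
      unfolding S_def by (rule image_eqI[where x = 1]) auto
    then show ?thesis using F(2)[of x] cInf_lower[OF _ bdd] by fastforce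
  qed
  have "\<bar>F x\<bar> \<le> 1 * norm x" for x
    using F1[of x] F1[of "- x"] norm_triangle_ineq[of w x] norm_triangle_ineq[of w "- x"]
    by (simp add: linear_neg[OF F(1)] abs_le_iff)
  then obtain f :: "'a \<Rightarrow>\<^sub>L real" where f: "\<And>x. blinfun_apply f x = F x" "norm f \<le> 1"
    using linear_bounded_blinfun[OF F(1), of 1] by auto
  have w0: "0 < norm w" using w by (simp add: smooth_point_def)
  \<comment> \<open>At \<open>- w\<close> the difference quotient with step one is
    \<open>- norm w\<close>, so \<open>F\<close> attains its full value at \<open>w\<close>.\<close>
  have "norm w \<le> F w" using F1[of "- w"] by (simp add: linear_neg[OF F(1)])
  moreover have "F w \<le> norm f * norm w" using norm_blinfun[of f w] f(1) by simp
  moreover have "norm f * norm w \<le> norm w" using f(2) w0 by simp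
  ultimately have "F w = norm w" "norm f * norm w = norm w" by linarith+
  then have "norm f = 1" "blinfun_apply f w = norm w" using w0 f(1) by auto
  then have "f = h" using w h unfolding smooth_point_def by blast
  then have "Inf (S d) < blinfun_apply h d + e" using F(3) f(1) e by auto
  then obtain a where "a \<in> S d" "a < blinfun_apply h d + e"
    using cInf_less_iff[OF _ bdd, of d] by (auto simp: S_def)
  then show ?thesis unfolding S_def by (auto simp: field_simps)
qed

section \<open>Reflexive spaces\<close>

text \<open>\<open>x\<close> is a weak cluster point of the sequence.\<close>
lemma reflexive_bounded_sequence:
  fixes z :: "nat \<Rightarrow> 'a::real_normed_vector"
  assumes refl: "reflexive_space TYPE('a)" and bounded: "\<And>k. norm (z k) \<le> R"
  shows "\<exists>x. \<forall>(f :: 'a \<Rightarrow>\<^sub>L real) c n. (\<forall>k\<ge>n. blinfun_apply f (z k) \<le> c) \<longrightarrow> blinfun_apply f x \<le> c"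
proof -
  \<comment> \<open>\<open>Inf (S f)\<close> is the upper limit of \<open>f (z k)\<close>. A linear
    functional below it lies in the bidual, so reflexivity represents it by a vector.\<close>
  define S where "S f = {c. \<exists>n. \<forall>k\<ge>n. blinfun_apply f (z k) \<le> c}" for f :: "'a \<Rightarrow>\<^sub>L real"
  have abs: "\<bar>blinfun_apply f (z k)\<bar> \<le> R * norm f" for f :: "'a \<Rightarrow>\<^sub>L real" and k
    using norm_blinfun[of f "z k"] mult_left_mono[OF bounded[of k] norm_ge_zero[of f]]
    by (simp add: mult.commute)
  have R: "0 \<le> R" using bounded[of 0] norm_ge_zero order_trans by blast
  have lower: "- (R * norm f) \<le> c" if c: "c \<in> S f" for c f
  proof -
    obtain n where "blinfun_apply f (z n) \<le> c" using c unfolding S_def by blast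
    then show ?thesis using abs[of f n] by linarith
  qed
  have bdd: "bdd_below (S f)" for f using lower unfolding bdd_below_def by blast
  have mem: "R * norm f \<in> S f" for f
    using abs[of f] unfolding S_def by (auto simp: abs_le_iff)
  have sub: "sublinear (\<lambda>f. Inf (S f))"
  proof (rule sublinear_Inf)
    show "S f \<noteq> {}" for f using mem by auto
    show "bdd_below (S f)" for f by (rule bdd)
  next
    fix f g a b assume "a \<in> S f" "b \<in> S g"
    then obtain n m where nm: "\<forall>k\<ge>n. blinfun_apply f (z k) \<le> a" "\<forall>k\<ge>m. blinfun_apply g (z k) \<le> b"
      unfolding S_def by blast
    then have "\<forall>k\<ge>max n m. blinfun_apply (f + g) (z k) \<le> a + b"
      by (auto simp: blinfun.add_left intro!: add_mono)
    then show "\<exists>c\<in>S (f + g). c \<le> a + b" unfolding S_def by blast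
  next
    fix f and t a :: real assume t: "0 < t" and "a \<in> S f"
    then have "t * a \<in> S (t *\<^sub>R f)" unfolding S_def by (auto simp: blinfun.scaleR_left)
    then show "\<exists>c\<in>S (t *\<^sub>R f). c \<le> t * a" by blast
  qed
  obtain F where F: "linear F" "\<And>f. F f \<le> Inf (S f)"
    using hahn_banach_sublinear[OF sub] by blast
  have FS: "F f \<le> c" if "c \<in> S f" for f c
    using F(2)[of f] cInf_lower[OF that bdd] by linarith
  have "\<bar>F f\<bar> \<le> R * norm f" for f
    using FS[OF mem, of f] FS[OF mem, of "- f"] by (simp add: linear_neg[OF F(1)] abs_le_iff)
  then obtain \<phi> :: "('a \<Rightarrow>\<^sub>L real) \<Rightarrow>\<^sub>L real" where \<phi>: "\<And>f. blinfun_apply \<phi> f = F f"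
    using linear_bounded_blinfun[OF F(1), of R] R by auto
  obtain x where "\<And>f. blinfun_apply \<phi> f = blinfun_apply f x"
    using refl unfolding reflexive_space_def by blast
  then have "\<And>f c. c \<in> S f \<Longrightarrow> blinfun_apply f x \<le> c"
    using FS \<phi> by metis
  then show ?thesis unfolding S_def by blast
qed

text \<open>Rational combinations, coded as lists of coefficient-vector pairs, so that countability
  is that of lists over a countable set.\<close>

lemma countable_dense_in_span:
  fixes B :: "'a::real_normed_vector set"
  assumes B: "countable B"
  shows "\<exists>C. countable C \<and> C \<subseteq> span B \<and> span B \<subseteq> closure C"
proof -
  define R where "R l = sum_list (map (\<lambda>(q, b). of_rat q *\<^sub>R b) l)" for l :: "(rat \<times> 'a) list"
  define C where "C = R ` lists (UNIV \<times> B)"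
  have "countable C"
    using B unfolding C_def by (intro countable_image countable_lists countable_SIGMA) auto
  moreover have "C \<subseteq> span B"
  proof -
    have "set l \<subseteq> UNIV \<times> B \<Longrightarrow> R l \<in> span B" for l
      by (induction l) (auto simp: R_def span_zero intro!: span_add span_scale intro: span_base)
    then show ?thesis unfolding C_def by auto
  qed
  moreover have "span B \<subseteq> closure C"
  proof
    have R_append: "R (l @ m) = R l + R m" for l m by (simp add: R_def)
    have R_scale: "of_rat q *\<^sub>R R l = R (map (\<lambda>(p, b). (q * p, b)) l)" for q l
      by (induction l) (auto simp: R_def scaleR_add_right of_rat_mult)
    have Cadd: "x + y \<in> C" if xy: "x \<in> C" "y \<in> C" for x y
    proof -
      obtain l m where "l \<in> lists (UNIV \<times> B)" "m \<in> lists (UNIV \<times> B)" "x = R l" "y = R m"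
        using xy unfolding C_def by blast
      then show ?thesis unfolding C_def by (intro image_eqI[where x = "l @ m"]) (auto simp: R_append)
    qed
    have Cscale: "of_rat q *\<^sub>R x \<in> C" if x: "x \<in> C" for x q
    proof -
      obtain l where l: "l \<in> lists (UNIV \<times> B)" "x = R l" using x unfolding C_def by blast
      have "map (\<lambda>(p, b). (q * p, b)) l \<in> lists (UNIV \<times> B)"
        using l(1) by (auto simp: lists_eq_set)
      then show ?thesis unfolding l(2) R_scale C_def by blast
    qed
    have one: "b \<in> C" if "b \<in> B" for b
      using that unfolding C_def by (intro image_eqI[where x = "[(1, b)]"]) (auto simp: R_def)
    fix x assume "x \<in> span B"
    then show "x \<in> closure C"
    proof (induction rule: span_induct_alt)
      case base
      have "[] \<in> lists (UNIV \<times> B)" by simp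
      then have "0 \<in> C" unfolding C_def by (intro image_eqI[where x = "[]"]) (auto simp: R_def)
      then show ?case using closure_subset by blast
    next
      case (step c b y)
      show ?case
        unfolding closure_approachable
      proof (intro allI impI)
        fix e :: real assume e: "0 < e"
        obtain y' where y': "y' \<in> C" "dist y' y < e / 2"
          using step e unfolding closure_approachable by (meson half_gt_zero)
        \<comment> \<open>The summand \<open>1\<close> in the denominator also covers
          \<open>b = 0\<close>.\<close>
        have "c < c + e / (2 * (norm b + 1))"
          using e by (simp add: add_nonneg_pos)
        then obtain q where q: "c < of_rat q" "of_rat q < c + e / (2 * (norm b + 1))"
          using of_rat_dense by blast
        have "norm (of_rat q *\<^sub>R b - c *\<^sub>R b) = (of_rat q - c) * norm b"
          using q(1) by (simp add: scaleR_diff_left[symmetric])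
        also have "\<dots> \<le> e / (2 * (norm b + 1)) * norm b"
          using q by (intro mult_right_mono) auto
        also have "\<dots> = e / 2 * (norm b / (norm b + 1))"
          by simp
        also have "\<dots> \<le> e / 2 * 1"
          using e by (intro mult_left_mono) (auto simp: divide_le_eq add_nonneg_pos)
        also have "\<dots> = e / 2" by simp
        finally have "norm (of_rat q *\<^sub>R b - c *\<^sub>R b) \<le> e / 2" .
        then have "dist (of_rat q *\<^sub>R b + y') (c *\<^sub>R b + y) < e"
          using y'(2) norm_triangle_ineq[of "of_rat q *\<^sub>R b - c *\<^sub>R b" "y' - y"]
          by (simp add: dist_norm algebra_simps)
        moreover have "of_rat q *\<^sub>R b + y' \<in> C"
          using Cadd Cscale one step.hyps y'(1) by blast
        ultimately show "\<exists>z\<in>C. dist z (c *\<^sub>R b + y) < e" by blast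
      qed
    qed
  qed
  ultimately show ?thesis by blast
qed

text \<open>Hahn-Banach gives an element of the bidual that vanishes on \<open>W\<close> but not at
  \<open>g\<close>; by reflexivity it is evaluation at a vector.\<close>

lemma reflexive_closed_subspace_separation:
  fixes W :: "('a::real_normed_vector \<Rightarrow>\<^sub>L real) set"
  assumes refl: "reflexive_space TYPE('a)" and W: "subspace W" and g: "g \<notin> closure W"
  shows "\<exists>x. (\<forall>f\<in>W. blinfun_apply f x = 0) \<and> blinfun_apply g x \<noteq> 0"
proof -
  obtain e where e: "0 < e" "\<And>f. f \<in> W \<Longrightarrow> e \<le> norm (g - f)"
    using g unfolding closure_approachable by (auto simp: dist_norm norm_minus_commute not_less)
  obtain F where F: "linear F" "\<And>f. \<bar>F f\<bar> \<le> norm f" "\<And>f. f \<in> W \<Longrightarrow> F f = 0" "e \<le> F g"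
    using hahn_banach_subspace[OF sublinear_norm norm_minus_cancel W e(2)] by blast
  obtain \<phi> :: "('a \<Rightarrow>\<^sub>L real) \<Rightarrow>\<^sub>L real" where \<phi>: "\<And>f. blinfun_apply \<phi> f = F f"
    using linear_bounded_blinfun[OF F(1), of 1] F(2) by auto
  obtain x where "\<And>f. blinfun_apply \<phi> f = blinfun_apply f x"
    using refl unfolding reflexive_space_def by blast
  then show ?thesis using \<phi> F(3,4) e(1) by (metis not_less)
qed

text \<open>A form of the fact that separable subspaces of the dual have separable duals: a functional
  bounded by the seminorm \<open>sup\<^sub>u \<bar>u z\<bar>\<close> lies in the closed span of \<open>D\<close>.\<close>
lemma reflexive_countable_functionals_separable:
  fixes D :: "('a::real_normed_vector \<Rightarrow>\<^sub>L real) set"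
  assumes refl: "reflexive_space TYPE('a)" and D: "countable D" and norm_D: "\<And>u. u \<in> D \<Longrightarrow> norm u \<le> 1"
  shows "\<exists>c :: nat \<Rightarrow> 'a. \<forall>z. \<forall>\<epsilon>>0. \<exists>n. \<forall>u\<in>D. \<bar>blinfun_apply u z - blinfun_apply u (c n)\<bar> < \<epsilon>"
proof -
  obtain D' where D': "countable D'" "D' \<subseteq> span D" "span D \<subseteq> closure D'"
    using countable_dense_in_span[OF D] by blast
  \<comment> \<open>Half of the norm is always reached on the unit ball. The span of the chosen
    points \<open>s d\<close> will be dense for the seminorm \<open>q\<close>.\<close>
  have "\<exists>x. norm x \<le> 1 \<and> norm d / 2 \<le> \<bar>blinfun_apply d x\<bar>" for d :: "'a \<Rightarrow>\<^sub>L real"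
  proof (rule ccontr)
    assume "\<not> ?thesis"
    then have *: "\<bar>blinfun_apply d x\<bar> < norm d / 2" if "norm x \<le> 1" for x
      using that by (meson not_le)
    have "norm (blinfun_apply d x) \<le> norm d / 2 * norm x" for x
    proof (cases "x = 0")
      case False
      then have "\<bar>blinfun_apply d (x /\<^sub>R norm x)\<bar> < norm d / 2"
        by (intro *) simp
      then show ?thesis using False
        by (simp add: blinfun.scaleR_right abs_mult field_simps)
    qed simp
    then have "norm d \<le> norm d / 2" by (intro norm_blinfun_bound) auto
    then show False using *[of 0] by simp
  qed
  then obtain s where s: "\<And>d :: 'a \<Rightarrow>\<^sub>L real. norm (s d) \<le> 1"
    "\<And>d. norm d / 2 \<le> \<bar>blinfun_apply d (s d)\<bar>"
    by metis
  obtain C where C: "countable C" "C \<subseteq> span (s ` D')" "span (s ` D') \<subseteq> closure C"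
    using countable_dense_in_span[of "s ` D'"] D'(1) by blast
  define q where "q z = (SUP u\<in>insert 0 D. \<bar>blinfun_apply u z\<bar>)" for z
  have le: "\<bar>blinfun_apply u z\<bar> \<le> norm z" if "u \<in> insert 0 D" for u z
  proof -
    have "norm u \<le> 1" using that norm_D by auto
    then show ?thesis
      using norm_blinfun[of u z] mult_right_mono[of "norm u" 1 "norm z"] by simp
  qed
  have bdd: "bdd_above ((\<lambda>u. \<bar>blinfun_apply u z\<bar>) ` insert 0 D)" for z
    using le by (intro bdd_aboveI2[where M = "norm z"]) auto
  have q_ge: "\<bar>blinfun_apply u z\<bar> \<le> q z" if "u \<in> D" for u z
    unfolding q_def using that by (intro cSUP_upper bdd) auto
  have q_le: "q z \<le> a" if "\<And>u. u \<in> insert 0 D \<Longrightarrow> \<bar>blinfun_apply u z\<bar> \<le> a" for z a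
    unfolding q_def using that by (intro cSUP_least) auto
  have q_norm: "q z \<le> norm z" for z by (rule q_le) (rule le)
  have q_nonneg: "0 \<le> q z" for z
    using cSUP_upper[OF _ bdd, of 0 z] unfolding q_def by simp
  have q_ge0: "\<bar>blinfun_apply u z\<bar> \<le> q z" if "u \<in> insert 0 D" for u z
    using that q_ge q_nonneg by auto
  have sub: "sublinear q"
    unfolding sublinear_def
  proof (intro conjI allI impI)
    fix x y show "q (x + y) \<le> q x + q y"
      using q_ge0 by (intro q_le) (auto simp: blinfun.add_right intro!: order_trans[OF abs_triangle_ineq] add_mono)
  next
    fix x and t :: real assume "0 < t"
    then show "q (t *\<^sub>R x) \<le> t * q x"
      using q_ge0 by (intro q_le) (auto simp: blinfun.scaleR_right abs_mult)
  qed
  have sym: "q (- x) = q x" for x by (simp add: q_def blinfun.minus_right)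
  have dense: "\<exists>c\<in>C. q (z - c) < \<epsilon>" if \<epsilon>: "0 < \<epsilon>" for z \<epsilon>
  proof (rule ccontr)
    assume no: "\<not> ?thesis"
    have far: "\<epsilon> / 2 \<le> q (z - w)" if w: "w \<in> span (s ` D')" for w
    proof -
      obtain c where c: "c \<in> C" "dist c w < \<epsilon> / 2"
        using C(3) w \<epsilon> unfolding closure_approachable by (meson closure_approachable half_gt_zero subsetD)
      have "q (z - c) \<le> q (z - w) + q (w - c)"
        using sublinear_add[OF sub, of "z - w" "w - c"] by simp
      moreover have "q (w - c) < \<epsilon> / 2"
        using q_norm[of "w - c"] c(2) by (simp add: dist_norm norm_minus_commute)
      moreover have "\<epsilon> \<le> q (z - c)" using no c(1) by (simp add: not_less)
      ultimately show ?thesis by linarith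
    qed
    obtain F where F: "linear F" "\<And>x. \<bar>F x\<bar> \<le> q x" "\<And>w. w \<in> span (s ` D') \<Longrightarrow> F w = 0" "\<epsilon> / 2 \<le> F z"
      using hahn_banach_subspace[OF sub sym subspace_span far] by blast
    have "\<bar>F x\<bar> \<le> 1 * norm x" for x using F(2)[of x] q_norm[of x] by linarith
    then obtain g :: "'a \<Rightarrow>\<^sub>L real" where g: "\<And>x. blinfun_apply g x = F x"
      using linear_bounded_blinfun[OF F(1), of 1] by auto
    \<comment> \<open>A vector annihilated by \<open>D\<close> has seminorm \<open>q\<close> zero,
      hence is annihilated by \<open>g\<close> too.\<close>
    have "g \<in> closure (span D)"
    proof (rule ccontr)
      assume "g \<notin> closure (span D)"
      then obtain x where x: "\<And>f. f \<in> span D \<Longrightarrow> blinfun_apply f x = 0" "blinfun_apply g x \<noteq> 0"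
        using reflexive_closed_subspace_separation[OF refl subspace_span] by blast
      have "q x \<le> 0" using x(1) by (intro q_le) (auto simp: span_base)
      then show False using F(2)[of x] g[of x] x(2) by simp
    qed
    then have "g \<in> closure D'"
      using closure_mono[OF D'(3)] by auto
    \<comment> \<open>For \<open>d\<close> close to \<open>g\<close>, the vector \<open>s d\<close>
      half-norms \<open>d\<close> but is killed by \<open>g\<close>, so
      \<open>norm d \<le> 2 * norm (d - g)\<close>.\<close>
    have "norm g \<le> 0 + e" if e: "0 < e" for e
    proof -
      obtain d where d: "d \<in> D'" "dist d g < e / 3"
        using \<open>g \<in> closure D'\<close> e unfolding closure_approachable by (metis divide_pos_pos zero_less_numeral)
      have "blinfun_apply g (s d) = 0" using F(3) g d(1) span_base by (metis imageI)
      then have "norm d / 2 \<le> \<bar>blinfun_apply (d - g) (s d)\<bar>"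
        using s(2)[of d] by (simp add: blinfun.diff_left)
      also have "\<dots> \<le> norm (d - g) * norm (s d)" using norm_blinfun[of "d - g" "s d"] by simp
      also have "\<dots> \<le> norm (d - g)" using s(1)[of d] by (simp add: mult_left_le)
      finally have "norm d \<le> 2 * norm (d - g)" by simp
      moreover have "norm g \<le> norm d + norm (d - g)"
        using norm_triangle_ineq4[of d "d - g"] by simp
      ultimately show ?thesis using d(2) by (simp add: dist_norm)
    qed
    then have "g = 0" using field_le_epsilon[of "norm g" 0] by simp
    then show False using g[of z] F(4) \<epsilon> by simp
  qed
  have "\<exists>n. \<forall>u\<in>D. \<bar>blinfun_apply u z - blinfun_apply u (from_nat_into C n)\<bar> < \<epsilon>" if \<epsilon>: "0 < \<epsilon>" for z \<epsilon>
  proof -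
    obtain c where c: "c \<in> C" "q (z - c) < \<epsilon>" using dense[OF \<epsilon>] by blast
    obtain n where "from_nat_into C n = c"
      using from_nat_into_surj[OF C(1) c(1)] by blast
    then show ?thesis
      using c(2) q_ge[of _ "z - c"] by (auto simp: blinfun.diff_right intro!: exI[of _ n] intro: le_less_trans)
  qed
  then show ?thesis by blast
qed

section \<open>Stegall's variational principle\<close>

context
  fixes C :: "'a::banach set" and \<phi> :: "'a \<Rightarrow> real" and R M :: real
  assumes nonempty: "C \<noteq> {}" and norm_le: "\<And>z. z \<in> C \<Longrightarrow> norm z \<le> R"
    and phi_le: "\<And>z. z \<in> C \<Longrightarrow> \<phi> z \<le> M"
begin

definition perturbed_sup :: "('a \<Rightarrow>\<^sub>L real) \<Rightarrow> real" where
  "perturbed_sup f = (SUP z\<in>C. \<phi> z + blinfun_apply f z)"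

definition near_max :: "('a \<Rightarrow>\<^sub>L real) \<Rightarrow> real \<Rightarrow> 'a set" where
  "near_max f \<delta> = {z \<in> C. perturbed_sup f - \<delta> \<le> \<phi> z + blinfun_apply f z}"

text \<open>These sets, for \<open>\<epsilon> = 1 / (n + 1)\<close>, are the open dense sets to
  which Baire's theorem is applied.\<close>

definition small_near_max :: "real \<Rightarrow> ('a \<Rightarrow>\<^sub>L real) set" where
  "small_near_max \<epsilon> = {f. \<exists>\<delta>>0. \<forall>z\<in>near_max f \<delta>. \<forall>w\<in>near_max f \<delta>. norm (z - w) < \<epsilon>}"

lemma R_nonneg: "0 \<le> R"
  using nonempty norm_le norm_ge_zero order_trans by (metis all_not_in_conv)

lemma apply_le: "z \<in> C \<Longrightarrow> \<bar>blinfun_apply f z\<bar> \<le> R * norm f"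
  using norm_blinfun[of f z] mult_left_mono[OF norm_le[of z] norm_ge_zero[of f]]
  by (simp add: mult.commute)

lemma bdd_above_perturbed: "bdd_above ((\<lambda>z. \<phi> z + blinfun_apply f z) ` C)"
proof (rule bdd_aboveI2)
  fix z assume "z \<in> C"
  then show "\<phi> z + blinfun_apply f z \<le> M + R * norm f"
    using phi_le[of z] apply_le[of z f] by linarith
qed

lemma perturbed_sup_upper: "z \<in> C \<Longrightarrow> \<phi> z + blinfun_apply f z \<le> perturbed_sup f"
  unfolding perturbed_sup_def by (intro cSUP_upper bdd_above_perturbed)

lemma near_max_nonempty:
  assumes "0 < \<delta>"
  shows "near_max f \<delta> \<noteq> {}"
proof -
  have "\<exists>z\<in>C. perturbed_sup f - \<delta> < \<phi> z + blinfun_apply f z"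
    using less_cSUP_iff[OF nonempty bdd_above_perturbed, of "perturbed_sup f - \<delta>" f] assms
    by (simp add: perturbed_sup_def)
  then show ?thesis by (auto simp: near_max_def intro: less_imp_le)
qed

section \<open>Near-maximisers under a change of the functional\<close>

lemma near_max_mono: "\<delta> \<le> \<delta>' \<Longrightarrow> near_max f \<delta> \<subseteq> near_max f \<delta>'"
  by (auto simp: near_max_def)

text \<open>On \<open>C\<close> the two perturbed functions differ by at most
  \<open>R * norm (g - f)\<close>. This enters twice: in the value at the point and in the
  supremum.\<close>

lemma near_max_perturb: "near_max g \<delta> \<subseteq> near_max f (\<delta> + 2 * R * norm (g - f))"
proof -
  have *: "\<bar>blinfun_apply g z - blinfun_apply f z\<bar> \<le> R * norm (g - f)" if "z \<in> C" for z
    using apply_le[OF that, of "g - f"] by (simp add: blinfun.diff_left)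
  have "perturbed_sup f \<le> perturbed_sup g + R * norm (g - f)"
    unfolding perturbed_sup_def[of f]
  proof (rule cSUP_least[OF nonempty])
    fix z assume z: "z \<in> C"
    show "\<phi> z + blinfun_apply f z \<le> perturbed_sup g + R * norm (g - f)"
      using *[OF z] perturbed_sup_upper[OF z, of g] by linarith
  qed
  then show ?thesis
    using * by (fastforce simp: near_max_def abs_le_iff)
qed

text \<open>The radius of the ball and the slack of the near-maximisers are the same number
  \<open>r\<close>, so a ball in the later tree needs no further parameter.\<close>

lemma near_max_cball:
  assumes "dist f g \<le> r"
  shows "near_max g r \<subseteq> near_max f (r * (1 + 2 * R))"
proof -
  have "r + 2 * R * norm (g - f) \<le> r * (1 + 2 * R)"
    using mult_left_mono[of "norm (g - f)" r "2 * R"] assms R_nonneg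
    by (simp add: dist_norm norm_minus_commute algebra_simps)
  then show ?thesis using near_max_perturb near_max_mono by blast
qed

text \<open>Adding the near-maximality inequalities of \<open>z\<close> against \<open>w\<close> and
  of \<open>w\<close> against \<open>z\<close> cancels \<open>\<phi>\<close> and \<open>f\<close>
  and leaves only the values of \<open>u\<close>.\<close>

lemma near_max_direction:
  assumes t: "0 < t" and z: "z \<in> near_max f (t * e)" and w: "w \<in> near_max (f + t *\<^sub>R u) (t * e)"
  shows "blinfun_apply u z - 2 * e \<le> blinfun_apply u w"
proof -
  have "z \<in> C" "w \<in> C" using z w by (auto simp: near_max_def)
  then have "t * blinfun_apply u z \<le> t * blinfun_apply u w + 2 * (t * e)"
    using z w perturbed_sup_upper[of w f] perturbed_sup_upper[of z "f + t *\<^sub>R u"]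
    by (auto simp: near_max_def blinfun.add_left blinfun.scaleR_left)
  then have "t * (blinfun_apply u z - 2 * e) \<le> t * blinfun_apply u w"
    by (simp add: algebra_simps)
  then show ?thesis using t by (rule mult_left_le_imp_le)
qed

lemma not_small_near_max:
  assumes "f \<notin> small_near_max \<epsilon>" "0 < \<delta>"
  shows "\<exists>z\<in>near_max f \<delta>. \<exists>w\<in>near_max f \<delta>. \<epsilon> \<le> norm (z - w)"
proof (rule ccontr)
  assume "\<not> ?thesis"
  then have "\<forall>z\<in>near_max f \<delta>. \<forall>w\<in>near_max f \<delta>. norm (z - w) < \<epsilon>" by (simp add: not_le)
  then have "f \<in> small_near_max \<epsilon>" using assms(2) unfolding small_near_max_def by blast
  then show False using assms(1) by contradiction
qed

text \<open>Take far apart near-maximisers \<open>z\<close>, \<open>w\<close> and a functional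
  \<open>u\<close> norming \<open>z - w\<close>. Moving \<open>f\<close> by a multiple of
  \<open>u\<close> pushes \<open>u\<close> on all near-maximisers up to about \<open>u z\<close>;
  moving by \<open>- u\<close> pushes it down to about \<open>u w\<close>.\<close>

lemma separating_balls:
  assumes bad: "f \<notin> small_near_max \<epsilon>" and \<epsilon>: "0 < \<epsilon>" and r: "0 < r"
  shows "\<exists>u r' f1 f2 a. norm u \<le> 1 \<and> 0 < r' \<and> r' \<le> r / 2
    \<and> cball f1 r' \<subseteq> ball f r \<and> cball f2 r' \<subseteq> ball f r
    \<and> (\<forall>g\<in>cball f1 r'. \<forall>z\<in>near_max g r'. a + \<epsilon> / 4 \<le> blinfun_apply u z)
    \<and> (\<forall>g\<in>cball f2 r'. \<forall>z\<in>near_max g r'. blinfun_apply u z \<le> a - \<epsilon> / 4)"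
proof -
  \<comment> \<open>A shift by \<open>t = r / 2\<close> and a radius of at most \<open>r / 4\<close>
    stay inside \<open>ball f r\<close>. The shift loses \<open>2 * e = \<epsilon> / 4\<close> of
    the half gap \<open>\<epsilon> / 2\<close>, and the second bound on \<open>r'\<close> keeps the
    slack below \<open>t * e\<close>.\<close>
  define t where "t = r / 2"
  define e where "e = \<epsilon> / 8"
  define r' where "r' = min (r / 4) (t * e / (1 + 2 * R))"
  have t: "0 < t" and e: "0 < e" using r \<epsilon> by (auto simp: t_def e_def)
  have r': "0 < r'" "r' \<le> r / 4" and r'R: "r' * (1 + 2 * R) \<le> t * e"
    using r t e R_nonneg by (auto simp: r'_def min_def field_simps add_pos_nonneg)
  have "0 < t * e" using t e by simp
  then obtain z w where zw: "z \<in> near_max f (t * e)" "w \<in> near_max f (t * e)" "\<epsilon> \<le> norm (z - w)"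
    using not_small_near_max[OF bad] by blast
  obtain u :: "'a \<Rightarrow>\<^sub>L real" where u: "norm u \<le> 1" "blinfun_apply u (z - w) = norm (z - w)"
    using ex_norming_functional by blast
  define a where "a = (blinfun_apply u z + blinfun_apply u w) / 2"
  have a: "a + \<epsilon> / 2 \<le> blinfun_apply u z" "blinfun_apply u w \<le> a - \<epsilon> / 2"
    using zw(3) u(2) by (auto simp: a_def blinfun.diff_right field_simps)
  have near: "near_max g r' \<subseteq> near_max f' (t * e)" if "g \<in> cball f' r'" for f' g
    using near_max_cball[of f' g r'] near_max_mono[OF r'R] that by auto
  have ball: "cball (f + s *\<^sub>R u) r' \<subseteq> ball f r" if "\<bar>s\<bar> = t" for s
  proof
    fix g assume "g \<in> cball (f + s *\<^sub>R u) r'"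
    then have "dist f g \<le> norm (s *\<^sub>R u) + r'"
      using dist_triangle[of f g "f + s *\<^sub>R u"] by (simp add: dist_norm)
    also have "norm (s *\<^sub>R u) \<le> t * 1" using u(1) t that by simp
    finally show "g \<in> ball f r" using r' r by (simp add: t_def)
  qed
  have "a + \<epsilon> / 4 \<le> blinfun_apply u y" if "g \<in> cball (f + t *\<^sub>R u) r'" "y \<in> near_max g r'" for g y
  proof -
    have "y \<in> near_max (f + t *\<^sub>R u) (t * e)" using near that by blast
    from near_max_direction[OF t zw(1) this] a show ?thesis by (simp add: e_def)
  qed
  moreover have "blinfun_apply u y \<le> a - \<epsilon> / 4"
    if "g \<in> cball (f + (- t) *\<^sub>R u) r'" "y \<in> near_max g r'" for g y
  proof -
    have "y \<in> near_max (f + t *\<^sub>R (- u)) (t * e)" using near that by fastforce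
    from near_max_direction[OF t zw(2) this] a show ?thesis
      by (simp add: e_def blinfun.minus_left)
  qed
  ultimately show ?thesis
    using u(1) r' ball[of t] ball[of "- t"] t r
    by (intro exI[of _ u] exI[of _ r'] exI[of _ "f + t *\<^sub>R u"] exI[of _ "f + (- t) *\<^sub>R u"] exI[of _ a])
      (auto simp del: scaleR_minus_left)
qed

lemma open_small_near_max: "open (small_near_max \<epsilon>)"
  unfolding open_dist
proof
  fix f assume "f \<in> small_near_max \<epsilon>"
  then obtain \<delta> where \<delta>: "0 < \<delta>" "\<forall>z\<in>near_max f \<delta>. \<forall>w\<in>near_max f \<delta>. norm (z - w) < \<epsilon>"
    unfolding small_near_max_def by blast
  define r where "r = \<delta> / (1 + 2 * R)"
  have r: "0 < r" "r * (1 + 2 * R) = \<delta>"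
    using \<delta>(1) R_nonneg by (auto simp: r_def add_pos_nonneg)
  have "g \<in> small_near_max \<epsilon>" if "dist g f < r" for g
  proof -
    have "near_max g r \<subseteq> near_max f \<delta>"
      using near_max_cball[of f g r] that r(2) by (simp add: dist_commute)
    then show ?thesis using r(1) \<delta>(2) unfolding small_near_max_def by blast
  qed
  then show "\<exists>e>0. \<forall>g. dist g f < e \<longrightarrow> g \<in> small_near_max \<epsilon>" using r(1) by blast
qed

text \<open>Otherwise every small ball contains two smaller ones whose near-maximisers are separated by a
  functional \<open>u\<close>, which gives a binary tree of balls. The countably many functionals involved
  induce a separable seminorm, and a branch that avoids a dense sequence leads to a contradiction.\<close>
lemma small_near_max_dense:
  assumes refl: "reflexive_space TYPE('a)" and \<epsilon>: "0 < \<epsilon>" and \<rho>: "0 < \<rho>"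
  shows "\<exists>f\<in>ball f0 \<rho>. f \<in> small_near_max \<epsilon>"
proof (rule ccontr)
  assume "\<not> ?thesis"
  then have bad: "\<And>f. f \<in> ball f0 \<rho> \<Longrightarrow> f \<notin> small_near_max \<epsilon>" by blast
  define valid where "valid P \<longleftrightarrow> 0 < snd P \<and> ball (fst P) (snd P) \<subseteq> ball f0 \<rho>"
    for P :: "('a \<Rightarrow>\<^sub>L real) \<times> real"
  define below where "below Q P \<longleftrightarrow> 0 < snd Q \<and> snd Q \<le> snd P / 2 \<and> cball (fst Q) (snd Q) \<subseteq> ball (fst P) (snd P)"
    for P Q :: "('a \<Rightarrow>\<^sub>L real) \<times> real"
  define maps_to where "maps_to P u A \<longleftrightarrow> (\<forall>g\<in>cball (fst P) (snd P). \<forall>z\<in>near_max g (snd P). blinfun_apply u z \<in> A)"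
    for P u and A :: "real set"
  \<comment> \<open>For each valid ball: a separating functional, and a choice \<open>Q\<close> of
    two child balls indexed by a truth value.\<close>
  have "\<exists>u Q. valid P \<longrightarrow> norm u \<le> 1 \<and> (\<forall>b. below (Q b) P)
      \<and> (\<exists>a. maps_to (Q True) u {a + \<epsilon> / 4..} \<and> maps_to (Q False) u {..a - \<epsilon> / 4})" for P
  proof (cases "valid P")
    case True
    then have "0 < snd P" "fst P \<in> ball f0 \<rho>"
      unfolding valid_def by (meson, meson centre_in_ball subsetD)
    then have "fst P \<notin> small_near_max \<epsilon>" "0 < snd P" using bad by blast+
    from separating_balls[OF this(1) \<epsilon> this(2)]
    obtain u r' f1 f2 a where sb: "norm u \<le> 1" "0 < r'" "r' \<le> snd P / 2"
      "cball f1 r' \<subseteq> ball (fst P) (snd P)" "cball f2 r' \<subseteq> ball (fst P) (snd P)"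
      "\<forall>g\<in>cball f1 r'. \<forall>z\<in>near_max g r'. a + \<epsilon> / 4 \<le> blinfun_apply u z"
      "\<forall>g\<in>cball f2 r'. \<forall>z\<in>near_max g r'. blinfun_apply u z \<le> a - \<epsilon> / 4"
      by blast
    have "maps_to (f1, r') u {a + \<epsilon> / 4..}" "maps_to (f2, r') u {..a - \<epsilon> / 4}"
      using sb(6,7) by (simp_all add: maps_to_def)
    moreover have "below (f1, r') P" "below (f2, r') P"
      using sb(2-5) by (simp_all add: below_def)
    ultimately show ?thesis
      using sb(1) by (intro exI[of _ u] exI[of _ "\<lambda>b. if b then (f1, r') else (f2, r')"]) auto
  qed simp
  then obtain U Q where UQ: "\<And>P. valid P \<Longrightarrow> norm (U P) \<le> 1" "\<And>P b. valid P \<Longrightarrow> below (Q P b) P"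
    "\<And>P. valid P \<Longrightarrow> \<exists>a. maps_to (Q P True) (U P) {a + \<epsilon> / 4..} \<and> maps_to (Q P False) (U P) {..a - \<epsilon> / 4}"
    by metis
  \<comment> \<open>The node reached by the word \<open>s\<close>. The latest decision is the head
    of the list, so \<open>b # s\<close> is a child of \<open>s\<close>.\<close>
  define N where "N s = foldr (\<lambda>b P. Q P b) s (f0, \<rho>)" for s
  have N_Cons: "N (b # s) = Q (N s) b" for b s by (simp add: N_def)
  have valid: "valid (N s)" for s
  proof (induction s)
    case Nil
    then show ?case using \<rho> by (simp add: N_def valid_def)
  next
    case (Cons b s)
    then have "below (N (b # s)) (N s)" unfolding N_Cons by (rule UQ(2))
    then show ?case using Cons unfolding below_def valid_def
      by (meson ball_subset_cball order_trans)
  qed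
  define D where "D = range (\<lambda>s. U (N s))"
  have "countable D" unfolding D_def by simp
  moreover have "\<And>u. u \<in> D \<Longrightarrow> norm u \<le> 1" using UQ(1)[OF valid] by (auto simp: D_def)
  ultimately obtain c :: "nat \<Rightarrow> 'a" where
    c: "\<And>z e. 0 < e \<Longrightarrow> \<exists>n. \<forall>u\<in>D. \<bar>blinfun_apply u z - blinfun_apply u (c n)\<bar> < e"
    using reflexive_countable_functionals_separable[OF refl] by blast
  define avoid where "avoid s n b \<longleftrightarrow> maps_to (N (b # s)) (U (N s)) {blinfun_apply (U (N s)) (c n) + \<epsilon> / 4..}
      \<or> maps_to (N (b # s)) (U (N s)) {..blinfun_apply (U (N s)) (c n) - \<epsilon> / 4}" for s n b
  \<comment> \<open>The value at \<open>c n\<close> lies on one side of the midpoint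
    \<open>a\<close>; the child on the other side stays at least \<open>\<epsilon> / 4\<close> away
    from it.\<close>
  have "\<exists>b. avoid s n b" for s n
  proof -
    obtain a where a: "maps_to (N (True # s)) (U (N s)) {a + \<epsilon> / 4..}"
        "maps_to (N (False # s)) (U (N s)) {..a - \<epsilon> / 4}"
      using UQ(3)[OF valid] unfolding N_Cons by blast
    have mono: "maps_to P u B" if "maps_to P u A" "A \<subseteq> B" for P u A B
      using that unfolding maps_to_def by blast
    show ?thesis
    proof (cases "blinfun_apply (U (N s)) (c n) \<le> a")
      case True
      then have "avoid s n True" unfolding avoid_def using mono[OF a(1)] by simp
      then show ?thesis ..
    next
      case False
      then have "avoid s n False" unfolding avoid_def using mono[OF a(2)] by simp
      then show ?thesis ..
    qed
  qed
  then obtain dir where dir: "\<And>s n. avoid s n (dir s n)" by metis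
  \<comment> \<open>At level \<open>n\<close> the branch avoids the point \<open>c n\<close> of the
    dense sequence.\<close>
  define path where "path = rec_nat [] (\<lambda>n s. dir s n # s)"
  have path_Suc: "path (Suc n) = dir (path n) n # path n" for n by (simp add: path_def)
  define B where "B n = cball (fst (N (path n))) (snd (N (path n)))" for n
  define r where "r n = snd (N (path n))" for n
  have below: "below (N (path (Suc n))) (N (path n))" for n
    unfolding path_Suc N_Cons by (rule UQ(2)[OF valid])
  have r_pos: "0 < r n" for n using valid unfolding valid_def r_def by blast
  have r_Suc: "r (Suc n) \<le> r n / 2" for n using below unfolding below_def r_def by blast
  have r_decseq: "r n \<le> r m" if "m \<le> n" for m n
  proof (rule lift_Suc_antimono_le[OF _ that])
    show "r (Suc n) \<le> r n" for n using r_Suc[of n] r_pos[of n] by linarith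
  qed
  have r_pow: "r n \<le> \<rho> * (1 / 2) ^ n" for n
  proof (induction n)
    case 0
    then show ?case by (simp add: r_def path_def N_def)
  next
    case (Suc n)
    then show ?case using r_Suc[of n] by simp
  qed
  have "B n \<subseteq> B m" if "m \<le> n" for m n
  proof (rule lift_Suc_antimono_le[OF _ that])
    show "B (Suc n) \<subseteq> B n" for n
      using below[of n] ball_subset_cball unfolding below_def B_def by blast
  qed
  moreover have "\<exists>n. \<forall>x\<in>B n. \<forall>y\<in>B n. dist x y < e" if e: "0 < e" for e
  proof -
    have "(\<lambda>n. \<rho> * (1 / 2 :: real) ^ n) \<longlonglongrightarrow> \<rho> * 0"
      by (intro tendsto_mult tendsto_const LIMSEQ_power_zero) simp
    then have "eventually (\<lambda>n. \<rho> * (1 / 2 :: real) ^ n < e / 2) sequentially"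
      using e by (intro order_tendstoD(2)) auto
    then obtain n where n: "r n < e / 2"
      using r_pow by (meson eventually_sequentially le_less_trans order_refl)
    have "dist x y < e" if "x \<in> B n" "y \<in> B n" for x y
      using that n dist_triangle3[of x y "fst (N (path n))"]
      by (simp add: B_def r_def)
    then show ?thesis by blast
  qed
  moreover have "closed (B n)" "B n \<noteq> {}" for n
    using r_pos[of n] by (auto simp: B_def r_def)
  ultimately obtain f where f: "\<And>n. f \<in> B n"
    using decreasing_closed_nest[of B] by blast
  \<comment> \<open>The functional \<open>f\<close> lies in every ball of the branch, so its
    near-maximisers obey all separations from some index on, and a weak cluster point inherits
    them.\<close>
  have "\<exists>z. z \<in> near_max f (r k)" for k using near_max_nonempty[OF r_pos] by blast
  then obtain z where z: "\<And>k. z k \<in> near_max f (r k)" by metis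
  have "norm (z k) \<le> R" for k using z[of k] by (auto simp: near_max_def norm_le)
  from reflexive_bounded_sequence[where z = z, OF refl this]
  obtain x where "\<forall>(g :: 'a \<Rightarrow>\<^sub>L real) b n. (\<forall>k\<ge>n. blinfun_apply g (z k) \<le> b) \<longrightarrow> blinfun_apply g x \<le> b" ..
  note x = this[THEN spec, THEN spec, THEN spec, THEN mp]
  have "\<epsilon> / 4 \<le> \<bar>blinfun_apply (U (N (path n))) x - blinfun_apply (U (N (path n))) (c n)\<bar>" for n
  proof -
    let ?u = "U (N (path n))"
    \<comment> \<open>The functional chosen at level \<open>n\<close> controls the child at level
      \<open>Suc n\<close>, hence the bound \<open>Suc n \<le> k\<close>.\<close>
    have val: "blinfun_apply ?u (z k) \<in> A" if "maps_to (N (path (Suc n))) ?u A" "Suc n \<le> k" for k A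
      using that(1) f[of "Suc n"] z[of k] near_max_mono[OF r_decseq[OF that(2)]]
      unfolding maps_to_def B_def r_def by blast
    from dir[of "path n" n, unfolded avoid_def, folded path_Suc] show ?thesis
    proof
      assume "maps_to (N (path (Suc n))) ?u {blinfun_apply ?u (c n) + \<epsilon> / 4..}"
      from val[OF this] have "\<forall>k\<ge>Suc n. blinfun_apply (- ?u) (z k) \<le> - (blinfun_apply ?u (c n) + \<epsilon> / 4)"
        unfolding blinfun.minus_left neg_le_iff_le by auto
      from x[OF this] show ?thesis unfolding blinfun.minus_left by linarith
    next
      assume "maps_to (N (path (Suc n))) ?u {..blinfun_apply ?u (c n) - \<epsilon> / 4}"
      from val[OF this] have "\<forall>k\<ge>Suc n. blinfun_apply ?u (z k) \<le> blinfun_apply ?u (c n) - \<epsilon> / 4"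
        by auto
      from x[OF this] show ?thesis by linarith
    qed
  qed
  moreover obtain n where "\<forall>u\<in>D. \<bar>blinfun_apply u x - blinfun_apply u (c n)\<bar> < \<epsilon> / 4"
    using c[of "\<epsilon> / 4" x] \<epsilon> by auto
  ultimately show False unfolding D_def by (meson not_less rangeI)
qed

text \<open>By Baire's theorem some functional of norm below \<open>\<rho>\<close> lies in all the
  open dense sets. Its near-maximisers have diameters tending to zero, so they form a Cauchy
  sequence whose limit is the strong maximum.\<close>

theorem stegall_variational_principle:
  assumes refl: "reflexive_space TYPE('a)" and C: "closed C" and cont: "continuous_on C \<phi>"
    and \<rho>: "0 < \<rho>"
  shows "\<exists>f x. norm f < \<rho> \<and> x \<in> C \<and> (\<forall>z\<in>C. \<phi> z + blinfun_apply f z \<le> \<phi> x + blinfun_apply f x)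
    \<and> (\<forall>\<epsilon>>0. \<exists>\<delta>>0. \<forall>z\<in>C. \<phi> x + blinfun_apply f x - \<delta> \<le> \<phi> z + blinfun_apply f z \<longrightarrow> norm (z - x) < \<epsilon>)"
proof -
  define G where "G = range (\<lambda>n. small_near_max (1 / real (Suc n)))"
  have "Met_TC.mtopology closure_of \<Inter>G = (UNIV :: ('a \<Rightarrow>\<^sub>L real) set)"
  proof (rule Met_TC.metric_Baire_category)
    show "Met_TC.mcomplete TYPE('a \<Rightarrow>\<^sub>L real)" by (simp add: complete_UNIV)
    show "countable G" by (simp add: G_def)
  next
    fix T assume "T \<in> G"
    then obtain n where T: "T = small_near_max (1 / real (Suc n))" unfolding G_def by blast
    have "closure T = UNIV"
    proof -
      have "f \<in> closure T" for f
        unfolding closure_approachable T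
      proof (intro allI impI)
        fix e :: real assume "0 < e"
        then obtain g where "g \<in> ball f e" "g \<in> small_near_max (1 / real (Suc n))"
          using small_near_max_dense[OF refl, of "1 / real (Suc n)" e f] by auto
        then show "\<exists>g\<in>small_near_max (1 / real (Suc n)). dist g f < e"
          by (auto simp: dist_commute)
      qed
      then show ?thesis by blast
    qed
    then show "openin Met_TC.mtopology T \<and> Met_TC.mtopology closure_of T = UNIV"
      using open_small_near_max by (simp add: T)
  qed
  then have "(0 :: 'a \<Rightarrow>\<^sub>L real) \<in> closure (\<Inter>G)" by simp
  then obtain f where f: "f \<in> \<Inter>G" "norm f < \<rho>"
    using \<rho> unfolding closure_approachable by (auto simp: dist_norm)
  have diam: "\<exists>\<delta>>0. \<forall>z\<in>near_max f \<delta>. \<forall>w\<in>near_max f \<delta>. norm (z - w) < \<epsilon>" if \<epsilon>: "0 < \<epsilon>" for \<epsilon>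
  proof -
    obtain n where n: "1 / real (Suc n) < \<epsilon>" using \<epsilon> by (metis inverse_eq_divide reals_Archimedean)
    have "f \<in> small_near_max (1 / real (Suc n))" using f(1) unfolding G_def by blast
    then obtain \<delta> where "0 < \<delta>"
        "\<forall>z\<in>near_max f \<delta>. \<forall>w\<in>near_max f \<delta>. norm (z - w) < 1 / real (Suc n)"
      unfolding small_near_max_def by blast
    then show ?thesis using less_trans[OF _ n] by (intro exI[of _ \<delta>]) blast
  qed
  have "\<exists>z. z \<in> near_max f (1 / real (Suc k))" for k
    using near_max_nonempty[of "1 / real (Suc k)" f] by auto
  then obtain z where z: "\<And>k. z k \<in> near_max f (1 / real (Suc k))" by metis
  have "Cauchy z"
    unfolding Cauchy_def
  proof (intro allI impI)
    fix \<epsilon> :: real assume "0 < \<epsilon>"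
    then obtain \<delta> where \<delta>: "0 < \<delta>" "\<forall>z\<in>near_max f \<delta>. \<forall>w\<in>near_max f \<delta>. norm (z - w) < \<epsilon>"
      using diam by blast
    obtain n where n: "1 / real (Suc n) < \<delta>" using \<delta>(1) by (metis inverse_eq_divide reals_Archimedean)
    have "z k \<in> near_max f \<delta>" if "n \<le> k" for k
    proof -
      have "1 / real (Suc k) \<le> 1 / real (Suc n)" using that by (intro divide_left_mono) auto
      then show ?thesis using near_max_mono[of "1 / real (Suc k)" \<delta>] z[of k] n by auto
    qed
    then show "\<exists>M. \<forall>m\<ge>M. \<forall>n\<ge>M. dist (z m) (z n) < \<epsilon>"
      using \<delta>(2) by (intro exI[of _ n]) (simp add: dist_norm)
  qed
  then obtain x where x: "z \<longlonglongrightarrow> x" using Cauchy_convergent_iff convergent_def by blast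
  have zC: "z k \<in> C" for k using z[of k] by (simp add: near_max_def)
  have xC: "x \<in> C" using closed_sequentially[OF C] zC x by blast
  have "(\<lambda>k. \<phi> (z k) + blinfun_apply f (z k)) \<longlonglongrightarrow> \<phi> x + blinfun_apply f x"
  proof (rule tendsto_add)
    show "(\<lambda>k. \<phi> (z k)) \<longlonglongrightarrow> \<phi> x"
      using continuous_on_tendsto_compose[OF cont x xC] zC by simp
    show "(\<lambda>k. blinfun_apply f (z k)) \<longlonglongrightarrow> blinfun_apply f x"
      by (intro blinfun.tendsto tendsto_const x)
  qed
  moreover have "(\<lambda>k. perturbed_sup f - 1 / real (Suc k)) \<longlonglongrightarrow> perturbed_sup f - 0"
    by (intro tendsto_diff tendsto_const LIMSEQ_Suc lim_1_over_n)
  ultimately have "perturbed_sup f - 0 \<le> \<phi> x + blinfun_apply f x"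
    using z by (intro LIMSEQ_le[of _ _ "\<lambda>k. \<phi> (z k) + blinfun_apply f (z k)"]) (auto simp: near_max_def)
  then have max: "\<phi> x + blinfun_apply f x = perturbed_sup f"
    using perturbed_sup_upper[OF xC, of f] by simp
  have "\<exists>\<delta>>0. \<forall>z\<in>C. \<phi> x + blinfun_apply f x - \<delta> \<le> \<phi> z + blinfun_apply f z \<longrightarrow> norm (z - x) < \<epsilon>"
    if \<epsilon>: "0 < \<epsilon>" for \<epsilon>
  proof -
    obtain \<delta> where \<delta>: "0 < \<delta>" "\<forall>z\<in>near_max f \<delta>. \<forall>w\<in>near_max f \<delta>. norm (z - w) < \<epsilon>"
      using diam[OF \<epsilon>] by blast
    have "x \<in> near_max f \<delta>" using xC \<delta>(1) by (simp add: near_max_def max)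
    then show ?thesis using \<delta> unfolding max near_max_def by blast
  qed
  then show ?thesis using f(2) xC perturbed_sup_upper max by metis
qed

end

section \<open>Smooth compact operators\<close>

lemma norm_blinfun_le_cball:
  fixes T :: "'a::real_normed_vector \<Rightarrow>\<^sub>L 'b::real_normed_vector"
  assumes "\<And>z. norm z \<le> 1 \<Longrightarrow> norm (blinfun_apply T z) \<le> b"
  shows "norm T \<le> b"
proof (rule norm_blinfun_bound)
  show "0 \<le> b" using assms[of 0] by simp
  fix z
  show "norm (blinfun_apply T z) \<le> b * norm z"
  proof (cases "z = 0")
    case False
    then have "norm (blinfun_apply T (z /\<^sub>R norm z)) \<le> b" by (intro assms) simp
    then show ?thesis using False by (simp add: blinfun.scaleR_right field_simps)
  qed simp
qed

lemma norm_blinfun_apply_le: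
  assumes "norm z \<le> 1"
  shows "norm (blinfun_apply T z) \<le> norm T"
  using norm_blinfun[of T z] mult_left_mono[OF assms norm_ge_zero[of T]] by simp

lemma norm_segment_le:
  fixes x y :: "'a::real_normed_vector"
  assumes "0 < s" "0 \<le> t" "t \<le> s"
  shows "norm (x + t *\<^sub>R y) \<le> (1 - t / s) * norm x + (t / s) * norm (x + s *\<^sub>R y)"
proof -
  have "x + t *\<^sub>R y = (1 - t / s) *\<^sub>R x + (t / s) *\<^sub>R (x + s *\<^sub>R y)"
    using assms(1) by (simp add: algebra_simps)
  then show ?thesis
    using norm_triangle_ineq[of "(1 - t / s) *\<^sub>R x" "(t / s) *\<^sub>R (x + s *\<^sub>R y)"] assms by simp
qed

section \<open>Rank one operators and smoothness through strong norm attainment\<close>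

definition rank_one :: "('a::real_normed_vector \<Rightarrow>\<^sub>L real) \<Rightarrow> 'b::real_normed_vector \<Rightarrow> 'a \<Rightarrow>\<^sub>L 'b" where
  "rank_one f u = blinfun_scaleR_left u o\<^sub>L f"

lemma rank_one_apply [simp]: "blinfun_apply (rank_one f u) z = blinfun_apply f z *\<^sub>R u"
  by (simp add: rank_one_def)

lemma norm_rank_one_le: "norm (rank_one f u) \<le> norm f * norm u"
proof (rule norm_blinfun_le_cball)
  fix z :: 'a assume "norm z \<le> 1"
  then show "norm (blinfun_apply (rank_one f u) z) \<le> norm f * norm u"
    using norm_blinfun_apply_le[of z f] by (simp add: mult_right_mono)
qed

lemma compact_operator_rank_one: "compact_operator (rank_one f u)"
proof -
  let ?K = "(\<lambda>r. r *\<^sub>R u) ` cball 0 (norm f)"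
  have "compact ?K"
    by (intro compact_continuous_image continuous_intros) simp
  moreover have "blinfun_apply (rank_one f u) ` cball 0 1 \<subseteq> ?K"
    using norm_blinfun_apply_le[of _ f] by auto
  ultimately have "compact (?K \<inter> closure (blinfun_apply (rank_one f u) ` cball 0 1))"
      "closure (blinfun_apply (rank_one f u) ` cball 0 1) \<subseteq> ?K"
    by (simp_all add: compact_Int_closed closure_minimal compact_imp_closed)
  then show ?thesis
    unfolding compact_operator_def by (simp add: Int_absorb1)
qed

lemma smooth_point_support_functional:
  fixes w :: "'a::real_normed_vector"
  assumes "smooth_point w"
  shows "\<exists>h :: 'a \<Rightarrow>\<^sub>L real. norm h = 1 \<and> blinfun_apply h w = norm w"
  using assms unfolding smooth_point_def by blast

text \<open>The convexity of \<open>t \<mapsto> \<parallel>A z + t S z\<parallel>\<close> transfers the directional derivative of the norm at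
  \<open>A x\<close> to points near \<open>x\<close>, uniformly in \<open>t\<close>; points away from \<open>x\<close> and \<open>-x\<close> do not matter.\<close>
lemma strong_maximum_norm_derivative:
  fixes A S :: "'a::real_normed_vector \<Rightarrow>\<^sub>L 'b::real_normed_vector"
  assumes A: "norm A = 1" "norm (blinfun_apply A x) = 1" and smooth: "smooth_point (blinfun_apply A x)"
    and h: "norm h = 1" "blinfun_apply h (blinfun_apply A x) = 1"
    and strong: "\<And>\<epsilon>. 0 < \<epsilon> \<Longrightarrow> \<exists>\<delta>>0. \<forall>z. norm z \<le> 1 \<longrightarrow> 1 - \<delta> \<le> norm (blinfun_apply A z)
        \<longrightarrow> norm (z - x) < \<epsilon> \<or> norm (z + x) < \<epsilon>"
    and e: "0 < e"
  shows "\<exists>t>0. norm (A + t *\<^sub>R S) \<le> 1 + t * (blinfun_apply h (blinfun_apply S x) + e)"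
proof -
  define c where "c = blinfun_apply h (blinfun_apply S x) + e"
  obtain s where s: "0 < s" "norm (blinfun_apply A x + s *\<^sub>R blinfun_apply S x) < 1 + s * c"
    using smooth_point_norm_derivative[OF smooth h(1) _ e, of "blinfun_apply S x"] h(2) A(2)
    unfolding c_def by auto
  let ?B = "A + s *\<^sub>R S"
  \<comment> \<open>Continuity extends the strict estimate from \<open>x\<close> to a ball around
    it, and linearity to the ball around \<open>- x\<close>.\<close>
  have "((\<lambda>z. norm (blinfun_apply ?B z)) \<longlongrightarrow> norm (blinfun_apply ?B x)) (at x)"
    by (intro tendsto_intros)
  moreover have Bx: "norm (blinfun_apply ?B x) < 1 + s * c"
    using s(2) by (simp add: blinfun.add_left blinfun.scaleR_left)
  ultimately have "eventually (\<lambda>z. norm (blinfun_apply ?B z) < 1 + s * c) (at x)"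
    by (rule order_tendstoD(2))
  then obtain \<epsilon> where \<epsilon>: "0 < \<epsilon>" "\<And>z. z \<noteq> x \<Longrightarrow> dist z x < \<epsilon> \<Longrightarrow> norm (blinfun_apply ?B z) < 1 + s * c"
    unfolding eventually_at by blast
  have near: "norm (blinfun_apply ?B z) < 1 + s * c" if "norm (z - x) < \<epsilon> \<or> norm (z + x) < \<epsilon>" for z
    using that
  proof
    assume "norm (z - x) < \<epsilon>"
    then show ?thesis using \<epsilon>(2)[of z] Bx by (cases "z = x") (auto simp: dist_norm)
  next
    assume "norm (z + x) < \<epsilon>"
    then have "norm (- z - x) < \<epsilon>" by (metis minus_add_distrib norm_minus_cancel uminus_add_conv_diff add.commute)
    then have "norm (blinfun_apply ?B (- z)) < 1 + s * c"
      using \<epsilon>(2)[of "- z"] Bx by (cases "- z = x") (auto simp: dist_norm)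
    then show ?thesis by (simp add: blinfun.minus_right)
  qed
  obtain \<delta> where \<delta>: "0 < \<delta>" "\<And>z. norm z \<le> 1 \<Longrightarrow> 1 - \<delta> \<le> norm (blinfun_apply A z) \<Longrightarrow> norm (z - x) < \<epsilon> \<or> norm (z + x) < \<epsilon>"
    using strong[OF \<epsilon>(1)] by blast
  \<comment> \<open>The bound \<open>t \<le> s\<close> permits the convexity argument near
    \<open>x\<close> and \<open>- x\<close>. The other bound ensures that points with
    \<open>norm (A z) < 1 - \<delta>\<close> cannot climb above \<open>1 + t * c\<close>, even for
    negative \<open>c\<close>.\<close>
  define t where "t = min s (\<delta> / (norm S + \<bar>c\<bar> + 1))"
  have pos: "0 < norm S + \<bar>c\<bar> + 1" by (simp add: add_nonneg_pos)
  have t: "0 < t" "t \<le> s" using s(1) \<delta>(1) pos by (auto simp: t_def)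
  have "t * (norm S + \<bar>c\<bar> + 1) \<le> \<delta>"
    unfolding t_def using pos by (simp add: pos_le_divide_eq[symmetric])
  moreover have "t * (norm S - c) \<le> t * (norm S + \<bar>c\<bar> + 1)"
    using t(1) by (intro mult_left_mono) auto
  ultimately have t\<delta>: "t * norm S \<le> \<delta> + t * c" by (simp add: algebra_simps)
  have "norm (A + t *\<^sub>R S) \<le> 1 + t * c"
  proof (rule norm_blinfun_le_cball)
    fix z :: 'a assume z: "norm z \<le> 1"
    let ?a = "blinfun_apply A z" and ?b = "blinfun_apply S z"
    have Az: "norm ?a \<le> 1" using norm_blinfun_apply_le[OF z, of A] A(1) by simp
    show "norm (blinfun_apply (A + t *\<^sub>R S) z) \<le> 1 + t * c"
    proof (cases "1 - \<delta> \<le> norm ?a")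
      case True
      then have "norm (blinfun_apply ?B z) \<le> 1 + s * c" using \<delta>(2)[OF z] near by fastforce
      then have B: "norm (?a + s *\<^sub>R ?b) \<le> 1 + s * c"
        by (simp add: blinfun.add_left blinfun.scaleR_left)
      have "norm (?a + t *\<^sub>R ?b) \<le> (1 - t / s) * norm ?a + (t / s) * norm (?a + s *\<^sub>R ?b)"
        using s(1) t by (intro norm_segment_le) auto
      also have "\<dots> \<le> (1 - t / s) * 1 + (t / s) * (1 + s * c)"
        using t s(1) B Az by (intro add_mono mult_left_mono) auto
      also have "\<dots> = 1 + t * c" using s(1) by (simp add: distrib_left)
      finally show ?thesis by (simp add: blinfun.add_left blinfun.scaleR_left)
    next
      case False
      have "norm (?a + t *\<^sub>R ?b) \<le> norm ?a + t * norm ?b"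
        using norm_triangle_ineq[of ?a "t *\<^sub>R ?b"] t(1) by simp
      also have "t * norm ?b \<le> t * norm S"
        using t(1) norm_blinfun_apply_le[OF z] by (intro mult_left_mono) auto
      finally show ?thesis using False t\<delta> by (simp add: blinfun.add_left blinfun.scaleR_left)
    qed
  qed
  then show ?thesis using t(1) unfolding c_def by blast
qed

text \<open>The support functional is \<open>S \<mapsto> h (S x)\<close>. Any other one lies below
  the one-sided derivative of the operator norm, hence below this one; applying that to
  \<open>- S\<close> gives equality.\<close>

lemma strong_maximum_imp_smooth_point:
  fixes T :: "('a::real_normed_vector, 'b::real_normed_vector) compact_op"
  defines "A \<equiv> blinfun_of_compact T"
  assumes A: "norm A = 1" "norm (blinfun_apply A x) = 1" and x: "norm x = 1"
    and smooth: "smooth_point (blinfun_apply A x)"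
    and strong: "\<And>\<epsilon>. 0 < \<epsilon> \<Longrightarrow> \<exists>\<delta>>0. \<forall>z. norm z \<le> 1 \<longrightarrow> 1 - \<delta> \<le> norm (blinfun_apply A z)
        \<longrightarrow> norm (z - x) < \<epsilon> \<or> norm (z + x) < \<epsilon>"
  shows "smooth_point T"
proof -
  obtain h :: "'b \<Rightarrow>\<^sub>L real" where h: "norm h = 1" "blinfun_apply h (blinfun_apply A x) = 1"
    using smooth_point_support_functional[OF smooth] A(2) by auto
  have T1: "norm T = 1" using A(1) by (simp add: norm_compact_op_def A_def)
  define F where "F S = blinfun_apply h (blinfun_apply (blinfun_of_compact S) x)" for S :: "('a, 'b) compact_op"
  have lin: "linear F"
    by (intro linearI) (simp_all add: F_def blinfun_of_compact_simps blinfun.bilinear_simps)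
  have "\<bar>F S\<bar> \<le> 1 * norm S" for S
  proof -
    have "\<bar>F S\<bar> \<le> norm h * norm (blinfun_apply (blinfun_of_compact S) x)"
      using norm_blinfun[of h] by (simp add: F_def)
    then show ?thesis
      using norm_blinfun_apply_le[of x "blinfun_of_compact S"] x h(1) by (simp add: norm_compact_op_def)
  qed
  then obtain \<Phi> :: "('a, 'b) compact_op \<Rightarrow>\<^sub>L real" where \<Phi>: "\<And>S. blinfun_apply \<Phi> S = F S" "norm \<Phi> \<le> 1"
    using linear_bounded_blinfun[OF lin, of 1] by auto
  have \<Phi>T: "blinfun_apply \<Phi> T = 1" using \<Phi>(1) h(2) by (simp add: F_def A_def)
  then have "norm \<Phi> = 1" using norm_blinfun[of \<Phi> T] \<Phi>(2) T1 by simp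
  moreover have "\<Psi> = \<Phi>" if \<Psi>: "norm \<Psi> = 1" "blinfun_apply \<Psi> T = norm T" for \<Psi>
  proof -
    have le: "blinfun_apply \<Psi> S \<le> F S" for S
    proof (rule field_le_epsilon)
      fix e :: real assume "0 < e"
      then obtain t where t: "0 < t" "norm (A + t *\<^sub>R blinfun_of_compact S) \<le> 1 + t * (F S + e)"
        using strong_maximum_norm_derivative[OF A smooth h strong, of e "blinfun_of_compact S"]
        unfolding F_def by blast
      have "1 + t * blinfun_apply \<Psi> S = blinfun_apply \<Psi> (T + t *\<^sub>R S)"
        using \<Psi>(2) T1 by (simp add: blinfun.bilinear_simps)
      also have "\<dots> \<le> norm (T + t *\<^sub>R S)"
        using norm_blinfun[of \<Psi> "T + t *\<^sub>R S"] \<Psi>(1) by simp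
      also have "\<dots> = norm (A + t *\<^sub>R blinfun_of_compact S)"
        by (simp add: norm_compact_op_def blinfun_of_compact_simps A_def)
      finally have "t * blinfun_apply \<Psi> S \<le> t * (F S + e)" using t(2) by simp
      then show "blinfun_apply \<Psi> S \<le> F S + e" using t(1) by (rule mult_left_le_imp_le)
    qed
    have "blinfun_apply \<Psi> S = F S" for S
      using le[of S] le[of "- S"] by (simp add: blinfun.minus_right linear_neg[OF lin])
    then show ?thesis using \<Phi>(1) by (intro blinfun_eqI) simp
  qed
  moreover have "T \<noteq> 0" using T1 by auto
  ultimately show ?thesis
    unfolding smooth_point_def using \<Phi>T T1 by metis
qed

text \<open>The rank one term points along \<open>T x\<close>, so at \<open>x\<close> the norms add
  up exactly to the maximum \<open>p\<close>, while elsewhere the triangle inequality keeps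
  \<open>norm (A z)\<close> below \<open>p\<close>.\<close>

lemma smooth_operator_perturbation:
  fixes T :: "'a::banach \<Rightarrow>\<^sub>L 'b::real_normed_vector"
  assumes refl: "reflexive_space TYPE('a)" and smooth: "smooth_space TYPE('b)"
    and T: "compact_operator T" "T \<noteq> 0" and \<rho>: "0 < \<rho>"
  shows "\<exists>B. norm B < \<rho> \<and> T + B \<noteq> 0
    \<and> inverse (norm (T + B)) *\<^sub>R (T + B) \<in> norm_one_smooth_compact_operators"
proof -
  let ?\<phi> = "\<lambda>z. norm (blinfun_apply T z)"
  have T0: "0 < norm T" using T(2) by simp
  have "continuous_on (cball 0 1) ?\<phi>" by (intro continuous_intros)
  then have "\<exists>f x. norm f < min \<rho> (norm T) \<and> x \<in> cball 0 1
    \<and> (\<forall>z\<in>cball 0 1. ?\<phi> z + blinfun_apply f z \<le> ?\<phi> x + blinfun_apply f x)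
    \<and> (\<forall>\<epsilon>>0. \<exists>\<delta>>0. \<forall>z\<in>cball 0 1. ?\<phi> x + blinfun_apply f x - \<delta> \<le> ?\<phi> z + blinfun_apply f z
        \<longrightarrow> norm (z - x) < \<epsilon>)"
    using refl \<rho> T0 norm_blinfun_apply_le[of _ T]
    by (intro stegall_variational_principle[where R = 1 and M = "norm T"]) auto
  then obtain f x where f: "norm f < min \<rho> (norm T)" and x1: "x \<in> cball 0 1"
    and max: "\<forall>z\<in>cball 0 1. ?\<phi> z + blinfun_apply f z \<le> ?\<phi> x + blinfun_apply f x"
    and strong: "\<forall>\<epsilon>>0. \<exists>\<delta>>0. \<forall>z\<in>cball 0 1. ?\<phi> x + blinfun_apply f x - \<delta> \<le> ?\<phi> z + blinfun_apply f z
        \<longrightarrow> norm (z - x) < \<epsilon>"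
    by blast
  define p where "p = ?\<phi> x + blinfun_apply f x"
  have le_p: "?\<phi> z + \<bar>blinfun_apply f z\<bar> \<le> p" if "norm z \<le> 1" for z
    using max[rule_format, of z] max[rule_format, of "- z"] that unfolding p_def
    by (simp add: blinfun.minus_right abs_le_iff)
  have fx: "0 \<le> blinfun_apply f x" using le_p[of x] x1 by (simp add: p_def)
  have "norm T \<le> p"
  proof (rule norm_blinfun_le_cball)
    fix z :: 'a assume "norm z \<le> 1"
    then show "?\<phi> z \<le> p" using le_p[of z] by linarith
  qed
  moreover have "blinfun_apply f x \<le> norm f"
    using norm_blinfun_apply_le[of x f] x1 by simp
  ultimately have Tx: "0 < ?\<phi> x" and p: "0 < p"
    using f T0 unfolding p_def by linarith+
  define u where "u = inverse (?\<phi> x) *\<^sub>R blinfun_apply T x"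
  have u: "norm u = 1" "blinfun_apply T x = ?\<phi> x *\<^sub>R u" using Tx by (simp_all add: u_def)
  define A where "A = T + rank_one f u"
  have A_apply: "blinfun_apply A z = blinfun_apply T z + blinfun_apply f z *\<^sub>R u" for z
    by (simp add: A_def blinfun.add_left)
  have A_le: "norm (blinfun_apply A z) \<le> ?\<phi> z + \<bar>blinfun_apply f z\<bar>" for z
    unfolding A_apply using norm_triangle_ineq[of "blinfun_apply T z" "blinfun_apply f z *\<^sub>R u"] u(1) by simp
  have Ax: "blinfun_apply A x = p *\<^sub>R u"
    unfolding A_apply p_def scaleR_add_left using u(2) by simp
  have normA: "norm A = p"
  proof (rule antisym)
    show "norm A \<le> p"
      using A_le le_p by (intro norm_blinfun_le_cball) (meson order_trans)
    show "p \<le> norm A"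
      using norm_blinfun_apply_le[of x A] x1 Ax u(1) p by simp
  qed
  have nx: "norm x = 1"
    using norm_blinfun[of A x] x1 Ax u(1) p normA by simp
  define A1 where "A1 = inverse p *\<^sub>R A"
  have A1_apply: "blinfun_apply A1 z = inverse p *\<^sub>R blinfun_apply A z" for z
    by (simp add: A1_def blinfun.scaleR_left)
  have A1x: "blinfun_apply A1 x = u" using p by (simp add: A1_apply Ax)
  have "compact_operator A1"
    unfolding A1_def A_def
    by (intro compact_operator_scaleR compact_operator_add T(1) compact_operator_rank_one)
  then have co: "blinfun_of_compact (Compact_op A1) = A1" by (simp add: Compact_op_inverse)
  have "norm A1 = 1" using p normA by (simp add: A1_def)
  have "smooth_point (Compact_op A1)"
  proof (rule strong_maximum_imp_smooth_point[where x = x]; (unfold co)?)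
    show "norm A1 = 1" "norm x = 1" by fact+
    show "norm (blinfun_apply A1 x) = 1" by (simp add: A1x u(1))
    show "smooth_point (blinfun_apply A1 x)"
      using smooth u(1) unfolding A1x smooth_space_def by force
  next
    fix \<epsilon> :: real assume "0 < \<epsilon>"
    then obtain \<delta> where \<delta>: "0 < \<delta>" "\<And>z. norm z \<le> 1 \<Longrightarrow> p - \<delta> \<le> ?\<phi> z + blinfun_apply f z \<Longrightarrow> norm (z - x) < \<epsilon>"
      using strong unfolding p_def by (metis mem_cball_0)
    have "norm (z - x) < \<epsilon> \<or> norm (z + x) < \<epsilon>"
      if z: "norm z \<le> 1" "1 - \<delta> / p \<le> norm (blinfun_apply A1 z)" for z
    proof -
      have "p * (1 - \<delta> / p) \<le> p * norm (blinfun_apply A1 z)"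
        using z(2) p by (intro mult_left_mono) auto
      then have "p - \<delta> \<le> norm (blinfun_apply A z)"
        using p by (simp add: A1_apply right_diff_distrib mult.assoc[symmetric])
      then have "p - \<delta> \<le> ?\<phi> z + \<bar>blinfun_apply f z\<bar>" using A_le[of z] by linarith
      \<comment> \<open>The sign of \<open>f z\<close> decides whether \<open>z\<close> or
        \<open>- z\<close> is a near-maximiser of the perturbed function.\<close>
      then have "norm (z - x) < \<epsilon> \<or> norm (- z - x) < \<epsilon>"
        using \<delta>(2)[of z] \<delta>(2)[of "- z"] z(1) by (cases "0 \<le> blinfun_apply f z") (auto simp: blinfun.minus_right)
      then show ?thesis by (metis add.commute minus_add_distrib norm_minus_cancel uminus_add_conv_diff)
    qed
    then show "\<exists>\<delta>>0. \<forall>z. norm z \<le> 1 \<longrightarrow> 1 - \<delta> \<le> norm (blinfun_apply A1 z)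
        \<longrightarrow> norm (z - x) < \<epsilon> \<or> norm (z + x) < \<epsilon>"
      using \<delta>(1) p by (intro exI[of _ "\<delta> / p"]) auto
  qed
  moreover have "norm (Compact_op A1) = 1"
    unfolding norm_compact_op_def co by fact
  ultimately have "A1 \<in> norm_one_smooth_compact_operators"
    unfolding norm_one_smooth_compact_operators_def using co by force
  moreover have "norm (rank_one f u) < \<rho>"
    using norm_rank_one_le[of f u] u(1) f by simp
  moreover have "A \<noteq> 0" using normA p by auto
  ultimately show ?thesis
    using normA unfolding A1_def A_def by blast
qed

section \<open>An operator of maximal determinant\<close>

lemma ex_unit_norm_gt:
  fixes T :: "'a::real_normed_vector \<Rightarrow>\<^sub>L 'b::real_normed_vector"
  assumes "b < norm T" "0 \<le> b"
  shows "\<exists>z. norm z = 1 \<and> b < norm (blinfun_apply T z)"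
proof (rule ccontr)
  assume "\<not> ?thesis"
  then have *: "norm (blinfun_apply T z) \<le> b" if "norm z = 1" for z
    using that by (meson not_less)
  have "norm (blinfun_apply T z) \<le> b * norm z" for z
  proof (cases "z = 0")
    case False
    then show ?thesis
      using *[of "z /\<^sub>R norm z"] by (simp add: blinfun.scaleR_right field_simps)
  qed simp
  then have "norm T \<le> b" by (intro norm_blinfun_bound assms(2))
  then show False using assms(1) by simp
qed

text \<open>Norming functionals corrected in the manner of Gram-Schmidt: \<open>b\<close> is moved
  into the kernel of \<open>f\<close>, and a multiple of \<open>f\<close> is subtracted from
  \<open>g0\<close> to make it vanish at \<open>a\<close>.\<close>

lemma biorthogonal_pair:
  fixes B :: "'a::real_normed_vector set"
  assumes B: "independent B" "card B = 2"
  shows "\<exists>(a::'a) b (f :: 'a \<Rightarrow>\<^sub>L real) (g :: 'a \<Rightarrow>\<^sub>L real). blinfun_apply f a = 1 \<and> blinfun_apply f b = 0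
    \<and> blinfun_apply g a = 0 \<and> blinfun_apply g b = 1"
proof -
  obtain a b0 where ab: "B = {a, b0}" "a \<noteq> b0"
    using B(2) by (auto simp: card_2_iff)
  have a: "a \<noteq> 0" using B(1) ab dependent_zero by blast
  obtain f0 :: "'a \<Rightarrow>\<^sub>L real" where f0: "blinfun_apply f0 a = norm a"
    using ex_norming_functional by blast
  define f where "f = inverse (norm a) *\<^sub>R f0"
  have fa: "blinfun_apply f a = 1" using f0 a by (simp add: f_def blinfun.scaleR_left)
  define b where "b = b0 - blinfun_apply f b0 *\<^sub>R a"
  have "b \<noteq> 0"
  proof
    assume "b = 0"
    then have "b0 \<in> span {a}" by (simp add: b_def span_singleton)
    then have "dependent B"
      unfolding dependent_def ab(1) using ab(2) by (intro bexI[of _ b0]) (auto simp: insert_Diff_if)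
    then show False using B(1) by contradiction
  qed
  obtain g0 :: "'a \<Rightarrow>\<^sub>L real" where g0: "blinfun_apply g0 b = norm b"
    using ex_norming_functional by blast
  have fb: "blinfun_apply f b = 0" using fa by (simp add: b_def blinfun.bilinear_simps)
  define g where "g = inverse (norm b) *\<^sub>R (g0 - blinfun_apply g0 a *\<^sub>R f)"
  have "blinfun_apply g a = 0" "blinfun_apply g b = 1"
    using fa fb g0 \<open>b \<noteq> 0\<close> by (simp_all add: g_def blinfun.bilinear_simps)
  then show ?thesis using fa fb by blast
qed

text \<open>For biorthogonal \<open>f, g\<close> and \<open>a, b\<close>: the projection onto the span of \<open>a, b\<close> followed by the
  matrix with rows \<open>(p, q)\<close> and \<open>(r, s)\<close>.\<close>
definition matrix_op ::
  "('a::real_normed_vector \<Rightarrow>\<^sub>L real) \<Rightarrow> ('a \<Rightarrow>\<^sub>L real) \<Rightarrow> 'a \<Rightarrow> 'a \<Rightarrow> real \<times> real \<times> real \<times> real \<Rightarrow> 'a \<Rightarrow>\<^sub>L 'a" where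
  "matrix_op f g a b = (\<lambda>(p, q, r, s). p *\<^sub>R rank_one f a + q *\<^sub>R rank_one g a
    + r *\<^sub>R rank_one f b + s *\<^sub>R rank_one g b)"

lemma matrix_op_apply:
  "blinfun_apply (matrix_op f g a b (p, q, r, s)) z =
    (p * blinfun_apply f z + q * blinfun_apply g z) *\<^sub>R a + (r * blinfun_apply f z + s * blinfun_apply g z) *\<^sub>R b"
  by (simp add: matrix_op_def blinfun.bilinear_simps algebra_simps)

lemma compact_operator_matrix_op: "compact_operator (matrix_op f g a b m)"
  unfolding matrix_op_def
  by (cases m) (auto intro!: compact_operator_add compact_operator_scaleR compact_operator_rank_one)

text \<open>The matrices giving norm at most one form a compact set, since the entries are
  \<open>f (T a)\<close>, \<open>f (T b)\<close>, \<open>g (T a)\<close>, \<open>g (T b)\<close>;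
  the continuous determinant attains its maximum there.\<close>

lemma maximal_determinant:
  fixes a b :: "'a::real_normed_vector"
  assumes fg: "blinfun_apply f a = 1" "blinfun_apply f b = 0" "blinfun_apply g a = 0" "blinfun_apply g b = 1"
  shows "\<exists>p q r s. norm (matrix_op f g a b (p, q, r, s)) = 1 \<and> 0 < p * s - q * r
    \<and> (\<forall>p' q' r' s'. p * s - q * r < p' * s' - q' * r' \<longrightarrow> 1 < norm (matrix_op f g a b (p', q', r', s')))"
proof -
  let ?T = "matrix_op f g a b"
  define det where "det = (\<lambda>(p, q, r, s :: real). p * s - q * r :: real)"
  define K where "K = {m. norm (?T m) \<le> 1}"
  have "continuous_on UNIV (\<lambda>m. norm (?T m))"
    unfolding matrix_op_def split_beta by (intro continuous_intros)
  then have "closed K" unfolding K_def by (rule closed_Collect_le) (rule continuous_on_const)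
  moreover have "bounded K"
  proof -
    have entry: "\<bar>blinfun_apply k (blinfun_apply (?T m) c)\<bar> \<le> norm k * norm c" if "m \<in> K" for k c m
    proof -
      have "\<bar>blinfun_apply k (blinfun_apply (?T m) c)\<bar> \<le> norm k * (norm (?T m) * norm c)"
        using norm_blinfun[of k "blinfun_apply (?T m) c"] mult_left_mono[OF norm_blinfun[of "?T m" c] norm_ge_zero[of k]]
        by simp
      also have "\<dots> \<le> norm k * (1 * norm c)"
        using that unfolding K_def by (intro mult_left_mono mult_right_mono) auto
      finally show ?thesis by simp
    qed
    have "K \<subseteq> cball 0 (norm f * norm a) \<times> cball 0 (norm f * norm b) \<times> cball 0 (norm g * norm a) \<times> cball 0 (norm g * norm b)"
    proof
      fix m assume m: "m \<in> K"
      obtain p q r s where "m = (p, q, r, s)" by (cases m)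
      then show "m \<in> cball 0 (norm f * norm a) \<times> cball 0 (norm f * norm b) \<times> cball 0 (norm g * norm a) \<times> cball 0 (norm g * norm b)"
        using entry[OF m, of f a] entry[OF m, of f b] entry[OF m, of g a] entry[OF m, of g b]
        by (simp add: matrix_op_apply blinfun.bilinear_simps fg)
    qed
    then show ?thesis by (rule bounded_subset[rotated]) (intro bounded_Times bounded_cball)
  qed
  ultimately have "compact K" by (simp add: compact_eq_bounded_closed)
  moreover have scale: "?T (c *\<^sub>R m) = c *\<^sub>R ?T m" for c m
    by (cases m) (simp add: matrix_op_def scaleR_add_right)
  \<comment> \<open>A small multiple of the identity matrix is admissible, so the maximal
    determinant is positive.\<close>
  define e where "e = inverse (norm (?T (1, 0, 0, 1)) + 1)"
  have e: "0 < e" by (simp add: e_def add_nonneg_pos)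
  have "e *\<^sub>R (1, 0, 0, 1) \<in> K"
    unfolding K_def using e by (simp only: mem_Collect_eq scale norm_scaleR) (simp add: e_def field_simps add_nonneg_pos)
  moreover have "continuous_on K det"
    unfolding det_def split_beta by (intro continuous_intros)
  ultimately obtain m where m: "m \<in> K" "\<And>m'. m' \<in> K \<Longrightarrow> det m' \<le> det m"
    using continuous_attains_sup[of K det] by blast
  have "det (e *\<^sub>R (1, 0, 0, 1)) = e * e" by (simp add: det_def)
  then have pos: "0 < det m"
    using m(2)[OF \<open>e *\<^sub>R (1, 0, 0, 1) \<in> K\<close>] e by (metis less_le_trans mult_pos_pos)
  have "norm (?T m) = 1"
  proof (rule ccontr)
    define n where "n = norm (?T m)"
    assume "norm (?T m) \<noteq> 1"
    then have n: "0 \<le> n" "n < 1" using m(1) by (auto simp: K_def n_def)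
    \<comment> \<open>If \<open>n < 1\<close>, the factor \<open>2 / (1 + n)\<close> enlarges the
      determinant and keeps the norm at most one.\<close>
    have c: "2 / (1 + n) * n \<le> 1" "1 < 2 / (1 + n)" using n by (simp_all add: field_simps)
    have "norm (?T ((2 / (1 + n)) *\<^sub>R m)) = 2 / (1 + n) * n"
      using n by (simp add: scale n_def)
    then have "(2 / (1 + n)) *\<^sub>R m \<in> K" using c(1) by (simp add: K_def)
    then have "det ((2 / (1 + n)) *\<^sub>R m) \<le> det m" by (rule m(2))
    moreover have "det (k *\<^sub>R m) = k * k * det m" for k
      by (cases m) (simp add: det_def algebra_simps)
    moreover have "1 * det m < 2 / (1 + n) * (2 / (1 + n)) * det m"
      using c(2) pos by (intro mult_strict_right_mono) (simp_all only: less_1_mult)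
    ultimately show False by simp
  qed
  moreover have "det m < det m' \<longrightarrow> 1 < norm (?T m')" for m'
    using m(2)[of m'] unfolding K_def by (metis mem_Collect_eq not_less)
  ultimately show ?thesis
    using pos unfolding det_def by (cases m) auto
qed

text \<open>With \<open>N\<close> shrinking \<open>v\<close> and expanding the kernel of \<open>h\<close> in the range of \<open>T\<close> twice as fast,
  \<open>(1 + s N) T\<close> has a larger determinant than the maximal one.\<close>
lemma ex_unstable_operator:
  fixes B :: "'a::real_normed_vector set"
  assumes smooth: "smooth_space TYPE('a)" and B: "independent B" "card B = 2"
  shows "\<exists>(T :: 'a \<Rightarrow>\<^sub>L 'a) v (h :: 'a \<Rightarrow>\<^sub>L real) N. compact_operator T \<and> norm T = 1
    \<and> v \<in> closure (blinfun_apply T ` cball 0 1) \<and> norm v = 1 \<and> norm h = 1 \<and> blinfun_apply h v = 1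
    \<and> (\<forall>y. blinfun_apply h (blinfun_apply N y) = - blinfun_apply h y)
    \<and> (\<forall>s. 0 < s \<longrightarrow> s < 1/2 \<longrightarrow> 1 < norm (T + s *\<^sub>R (N o\<^sub>L T)))"
proof -
  obtain a b :: 'a and f g :: "'a \<Rightarrow>\<^sub>L real" where fg: "blinfun_apply f a = 1" "blinfun_apply f b = 0"
    "blinfun_apply g a = 0" "blinfun_apply g b = 1"
    using biorthogonal_pair[OF B] by blast
  let ?T = "matrix_op f g a b"
  obtain p q r s where T1: "norm (?T (p, q, r, s)) = 1" and pos: "0 < p * s - q * r"
    and max: "\<And>p' q' r' s'. p * s - q * r < p' * s' - q' * r' \<Longrightarrow> 1 < norm (?T (p', q', r', s'))"
    using maximal_determinant[OF fg] by blast
  define T where "T = ?T (p, q, r, s)"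
  have T_apply: "blinfun_apply T z = (p * blinfun_apply f z + q * blinfun_apply g z) *\<^sub>R a
      + (r * blinfun_apply f z + s * blinfun_apply g z) *\<^sub>R b" for z
    by (simp add: T_def matrix_op_apply)
  have normT: "norm T = 1" using T1 by (simp add: T_def)
  have co: "compact_operator T" by (simp add: T_def compact_operator_matrix_op)
  let ?K = "closure (blinfun_apply T ` cball 0 1)"
  have "blinfun_apply T ` cball 0 1 \<noteq> {}" by simp
  then have "?K \<noteq> {}" by simp
  then obtain v where v: "v \<in> ?K" "\<And>y. y \<in> ?K \<Longrightarrow> norm y \<le> norm v"
    using continuous_attains_sup[of ?K norm] co unfolding compact_operator_def
    by (auto intro: continuous_intros)
  have "?K \<subseteq> cball 0 1"
    using norm_blinfun_apply_le[of _ T] normT by (intro closure_minimal) auto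
  moreover have "1 \<le> norm v"
    unfolding normT[symmetric]
  proof (rule norm_blinfun_le_cball)
    fix z :: 'a assume "norm z \<le> 1"
    then have "blinfun_apply T z \<in> ?K" by (intro subsetD[OF closure_subset] imageI) simp
    then show "norm (blinfun_apply T z) \<le> norm v" by (rule v(2))
  qed
  ultimately have nv: "norm v = 1" using v(1) by auto
  define v1 v2 where "v1 = blinfun_apply f v" and "v2 = blinfun_apply g v"
  \<comment> \<open>The span of \<open>a\<close>, \<open>b\<close> is the fixed set of a continuous
    projection, hence closed, so \<open>v\<close> stays in it.\<close>
  have "?K \<subseteq> {y. y = blinfun_apply f y *\<^sub>R a + blinfun_apply g y *\<^sub>R b}"
  proof (rule closure_minimal)
    show "blinfun_apply T ` cball 0 1 \<subseteq> {y. y = blinfun_apply f y *\<^sub>R a + blinfun_apply g y *\<^sub>R b}"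
      by (auto simp: T_apply blinfun.bilinear_simps fg)
    show "closed {y. y = blinfun_apply f y *\<^sub>R a + blinfun_apply g y *\<^sub>R b}"
      by (intro closed_Collect_eq continuous_intros)
  qed
  then have v_eq: "v = v1 *\<^sub>R a + v2 *\<^sub>R b" using v(1) by (auto simp: v1_def v2_def)
  have "smooth_point v" using smooth nv unfolding smooth_space_def by force
  then obtain h :: "'a \<Rightarrow>\<^sub>L real" where h: "norm h = 1" "blinfun_apply h v = 1"
    using smooth_point_support_functional nv by metis
  define h1 h2 where "h1 = blinfun_apply h a" and "h2 = blinfun_apply h b"
  have hv: "h1 * v1 + h2 * v2 = 1"
    using h(2) unfolding v_eq by (simp add: blinfun.bilinear_simps h1_def h2_def algebra_simps)
  \<comment> \<open>\<open>e\<close> lies in the kernel of \<open>h\<close>, and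
    \<open>v1 g - v2 f\<close> vanishes at \<open>v\<close> and equals \<open>1\<close> at
    \<open>e\<close>. Hence \<open>N v = - v\<close> and \<open>N e = 2 e\<close>.\<close>
  define e where "e = h1 *\<^sub>R b - h2 *\<^sub>R a"
  have he: "blinfun_apply h e = 0" by (simp add: e_def blinfun.bilinear_simps h1_def h2_def)
  define N where "N = 2 *\<^sub>R rank_one (v1 *\<^sub>R g - v2 *\<^sub>R f) e - rank_one h v"
  have N_apply: "blinfun_apply N y
      = (2 * (v1 * blinfun_apply g y - v2 * blinfun_apply f y)) *\<^sub>R e - blinfun_apply h y *\<^sub>R v" for y
    by (simp add: N_def blinfun.bilinear_simps)
  have hN: "blinfun_apply h (blinfun_apply N y) = - blinfun_apply h y" for y
    by (simp add: N_apply blinfun.bilinear_simps he h(2))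
  have "1 < norm (T + t *\<^sub>R (N o\<^sub>L T))" if t: "0 < t" "t < 1/2" for t
  proof -
    \<comment> \<open>The matrix of \<open>1 + t N\<close> in the basis \<open>a\<close>,
      \<open>b\<close>. Its eigenvalues are \<open>1 - t\<close> and \<open>1 + 2 * t\<close>, whose
      product exceeds one exactly for \<open>0 < t < 1/2\<close>.\<close>
    define m11 m12 m21 m22 where "m11 = 1 + t * (2 * v2 * h2 - h1 * v1)" and "m12 = - 3 * t * (h2 * v1)"
      and "m21 = - 3 * t * (h1 * v2)" and "m22 = 1 + t * (2 * v1 * h1 - h2 * v2)"
    note m_defs = m11_def m12_def m21_def m22_def
    have det: "m11 * m22 - m12 * m21 = (1 - t) * (1 + 2 * t)"
    proof -
      define k where "k = h1 * v1"
      have k: "v1 * h1 = k" "h2 * v2 = 1 - k" "v2 * h2 = 1 - k"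
        using hv by (simp_all add: k_def algebra_simps)
      have "2 * v2 * h2 - h1 * v1 = 2 - 3 * k" "2 * v1 * h1 - h2 * v2 = 3 * k - 1"
        by (simp_all add: k k_def[symmetric] mult.assoc)
      then have diag: "m11 = 1 + t * (2 - 3 * k)" "m22 = 1 + t * (3 * k - 1)"
        by (simp_all add: m_defs)
      have off_diag: "m12 * m21 = 9 * t * t * ((h1 * v1) * (h2 * v2))"
        by (simp add: m_defs)
      show ?thesis
        unfolding diag off_diag k(2) k_def[symmetric] by (simp add: algebra_simps)
    qed
    have "T + t *\<^sub>R (N o\<^sub>L T) = ?T (m11 * p + m12 * r, m11 * q + m12 * s, m21 * p + m22 * r, m21 * q + m22 * s)"
    proof (rule blinfun_eqI)
      fix z
      define \<alpha> \<beta> where "\<alpha> = p * blinfun_apply f z + q * blinfun_apply g z"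
        and "\<beta> = r * blinfun_apply f z + s * blinfun_apply g z"
      have y: "blinfun_apply T z = \<alpha> *\<^sub>R a + \<beta> *\<^sub>R b" by (simp add: T_apply \<alpha>_def \<beta>_def)
      have combine: "(\<alpha> *\<^sub>R a + \<beta> *\<^sub>R b) + t *\<^sub>R (\<kappa> *\<^sub>R e - \<mu> *\<^sub>R v)
          = (\<alpha> - t * (\<kappa> * h2 + \<mu> * v1)) *\<^sub>R a + (\<beta> + t * (\<kappa> * h1 - \<mu> * v2)) *\<^sub>R b" for \<kappa> \<mu>
        unfolding v_eq e_def by (simp add: algebra_simps)
      have "blinfun_apply (T + t *\<^sub>R (N o\<^sub>L T)) z = (\<alpha> *\<^sub>R a + \<beta> *\<^sub>R b)
          + t *\<^sub>R ((2 * (v1 * \<beta> - v2 * \<alpha>)) *\<^sub>R e - (\<alpha> * h1 + \<beta> * h2) *\<^sub>R v)"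
        unfolding blinfun.add_left blinfun.scaleR_left blinfun_apply_blinfun_compose y N_apply
        by (simp add: blinfun.bilinear_simps fg h1_def h2_def)
      also have "\<dots> = (\<alpha> - t * (2 * (v1 * \<beta> - v2 * \<alpha>) * h2 + (\<alpha> * h1 + \<beta> * h2) * v1)) *\<^sub>R a
          + (\<beta> + t * (2 * (v1 * \<beta> - v2 * \<alpha>) * h1 - (\<alpha> * h1 + \<beta> * h2) * v2)) *\<^sub>R b"
        by (rule combine)
      also have "\<alpha> - t * (2 * (v1 * \<beta> - v2 * \<alpha>) * h2 + (\<alpha> * h1 + \<beta> * h2) * v1) = m11 * \<alpha> + m12 * \<beta>"
        by (simp add: m_defs algebra_simps)
      also have "\<beta> + t * (2 * (v1 * \<beta> - v2 * \<alpha>) * h1 - (\<alpha> * h1 + \<beta> * h2) * v2) = m21 * \<alpha> + m22 * \<beta>"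
        by (simp add: m_defs algebra_simps)
      also have "(m11 * \<alpha> + m12 * \<beta>) *\<^sub>R a + (m21 * \<alpha> + m22 * \<beta>) *\<^sub>R b = blinfun_apply (?T (m11 * p + m12 * r, m11 * q + m12 * s, m21 * p + m22 * r, m21 * q + m22 * s)) z"
        by (simp add: matrix_op_apply \<alpha>_def \<beta>_def algebra_simps)
      finally show "blinfun_apply (T + t *\<^sub>R (N o\<^sub>L T)) z
        = blinfun_apply (?T (m11 * p + m12 * r, m11 * q + m12 * s, m21 * p + m22 * r, m21 * q + m22 * s)) z" .
    qed
    moreover have "p * s - q * r < (m11 * p + m12 * r) * (m21 * q + m22 * s) - (m11 * q + m12 * s) * (m21 * p + m22 * r)"
    proof -
      have "(m11 * p + m12 * r) * (m21 * q + m22 * s) - (m11 * q + m12 * s) * (m21 * p + m22 * r)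
          = (m11 * m22 - m12 * m21) * (p * s - q * r)"
        by (simp add: algebra_simps)
      moreover have "1 < (1 - t) * (1 + 2 * t)"
        using mult_pos_pos[of t "1 - 2 * t"] t by (simp add: algebra_simps)
      ultimately show ?thesis using pos by (simp add: det)
    qed
    ultimately show ?thesis using max by metis
  qed
  then show ?thesis using co normT v(1) nv h hN by blast
qed

text \<open>If \<open>h (T y)\<close> were close to \<open>1\<close> in absolute value for all near-maximisers \<open>y\<close> of \<open>T\<close>, then by smoothness
  the norm would decrease in the direction \<open>N\<close> near their images.\<close>
lemma unstable_operator_second_maximiser:
  fixes T :: "'a::real_normed_vector \<Rightarrow>\<^sub>L 'b::real_normed_vector"
  assumes smooth: "smooth_space TYPE('b)" and co: "compact_operator T" and T1: "norm T = 1"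
    and h: "norm (h :: 'b \<Rightarrow>\<^sub>L real) = 1" and hN: "\<And>y. blinfun_apply h (blinfun_apply N y) = - blinfun_apply h y"
    and unstable: "\<And>s. 0 < s \<Longrightarrow> s < 1/2 \<Longrightarrow> 1 < norm (T + s *\<^sub>R (N o\<^sub>L T))"
  shows "\<exists>\<delta>>0. \<forall>\<eta>>0. \<exists>y. norm y = 1 \<and> 1 - \<eta> < norm (blinfun_apply T y)
    \<and> \<bar>blinfun_apply h (blinfun_apply T y)\<bar> < 1 - \<delta>"
proof (rule ccontr)
  assume contra: "\<not> ?thesis"
  have near: "\<exists>\<eta>>0. \<forall>y. norm y = 1 \<longrightarrow> 1 - \<eta> < norm (blinfun_apply T y)
      \<longrightarrow> 1 - \<delta> \<le> \<bar>blinfun_apply h (blinfun_apply T y)\<bar>" if \<delta>: "0 < \<delta>" for \<delta>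
  proof -
    obtain \<eta> where "0 < \<eta>" "\<And>y. \<not> (norm y = 1 \<and> 1 - \<eta> < norm (blinfun_apply T y)
        \<and> \<bar>blinfun_apply h (blinfun_apply T y)\<bar> < 1 - \<delta>)"
      using contra \<delta> by blast
    then show ?thesis by (metis not_less)
  qed
  \<comment> \<open>The offset \<open>3\<close> keeps every \<open>s n\<close> below
    \<open>1/2\<close>, the range of the instability assumption.\<close>
  define s where "s n = 1 / real (n + 3)" for n
  have s: "0 < s n" "s n < 1/2" for n by (simp_all add: s_def field_simps)
  have s_lim: "s \<longlonglongrightarrow> 0" unfolding s_def using LIMSEQ_ignore_initial_segment[OF lim_1_over_n] .
  have "\<exists>z. norm z = 1 \<and> 0 \<le> blinfun_apply h (blinfun_apply T z)
      \<and> 1 < norm (blinfun_apply T z + s n *\<^sub>R blinfun_apply N (blinfun_apply T z))" for n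
  proof -
    obtain z where z: "norm z = 1" "1 < norm (blinfun_apply (T + s n *\<^sub>R (N o\<^sub>L T)) z)"
      using ex_unit_norm_gt[OF unstable[OF s]] by auto
    define z' where "z' = (if 0 \<le> blinfun_apply h (blinfun_apply T z) then z else - z)"
    have "norm z' = 1" "0 \<le> blinfun_apply h (blinfun_apply T z')"
      using z(1) by (auto simp: z'_def blinfun.minus_right)
    moreover have "norm (blinfun_apply (T + s n *\<^sub>R (N o\<^sub>L T)) z') = norm (blinfun_apply (T + s n *\<^sub>R (N o\<^sub>L T)) z)"
      unfolding z'_def by (simp only: blinfun.minus_right norm_minus_cancel split: if_split) simp
    ultimately show ?thesis using z(2)
      by (intro exI[of _ z']) (simp add: blinfun.add_left blinfun.scaleR_left)
  qed
  then obtain z where z: "\<And>n. norm (z n) = 1" "\<And>n. 0 \<le> blinfun_apply h (blinfun_apply T (z n))"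
    "\<And>n. 1 < norm (blinfun_apply T (z n) + s n *\<^sub>R blinfun_apply N (blinfun_apply T (z n)))"
    by metis
  define w where "w n = blinfun_apply T (z n)" for n
  have w1: "norm (w n) \<le> 1" for n
    using norm_blinfun_apply_le[of "z n" T] z(1) T1 by (simp add: w_def)
  have "w n \<in> closure (blinfun_apply T ` cball 0 1)" for n
    using z(1) closure_subset unfolding w_def by (intro subsetD[OF closure_subset] imageI) simp
  then obtain l r where lr: "strict_mono (r :: nat \<Rightarrow> nat)" "(w \<circ> r) \<longlonglongrightarrow> l"
    using co unfolding compact_operator_def compact_eq_seq_compact_metric seq_compact_def by metis
  \<comment> \<open>As \<open>s n\<close> tends to zero, the points \<open>z n\<close> almost attain
    the norm of \<open>T\<close>; the negated claim and the choice of sign then drive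
    \<open>h (w n)\<close> to \<open>1\<close>.\<close>
  have hw: "(\<lambda>n. blinfun_apply h (w n)) \<longlonglongrightarrow> 1"
  proof (rule LIMSEQ_I)
    fix \<delta> :: real assume "0 < \<delta>"
    then obtain \<eta> where \<eta>: "0 < \<eta>" "\<And>y. norm y = 1 \<Longrightarrow> 1 - \<eta> < norm (blinfun_apply T y)
        \<Longrightarrow> 1 - \<delta> / 2 \<le> \<bar>blinfun_apply h (blinfun_apply T y)\<bar>"
      using near[of "\<delta> / 2"] by auto
    have "(\<lambda>n. s n * norm N) \<longlonglongrightarrow> 0 * norm N" by (intro tendsto_intros s_lim)
    then have "eventually (\<lambda>n. s n * norm N < \<eta>) sequentially"
      using \<eta>(1) by (intro order_tendstoD(2)) auto
    then obtain n0 where n0: "\<And>n. n0 \<le> n \<Longrightarrow> s n * norm N < \<eta>"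
      unfolding eventually_sequentially by blast
    have "norm (blinfun_apply h (w n) - 1) < \<delta>" if "n0 \<le> n" for n
    proof -
      have "norm (blinfun_apply N (w n)) \<le> norm N"
        by (rule norm_blinfun_apply_le[OF w1])
      then have "s n * norm (blinfun_apply N (w n)) < \<eta>"
        using n0[OF that] mult_left_mono[of _ "norm N" "s n"] s(1)[of n] by (meson le_less_trans less_imp_le)
      then have "1 - \<eta> < norm (w n)"
        using z(3)[of n] norm_triangle_ineq[of "w n" "s n *\<^sub>R blinfun_apply N (w n)"] s(1)[of n]
        by (simp add: w_def)
      then have "1 - \<delta> / 2 \<le> blinfun_apply h (w n)"
        using \<eta>(2)[OF z(1)[of n]] z(2)[of n] by (simp add: w_def)
      moreover have "blinfun_apply h (w n) \<le> 1"
        using norm_blinfun_apply_le[OF w1, of h n] h by simp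
      ultimately show ?thesis using \<open>0 < \<delta>\<close> by simp
    qed
    then show "\<exists>n0. \<forall>n\<ge>n0. norm (blinfun_apply h (w n) - 1) < \<delta>" by blast
  qed
  have "(\<lambda>n. blinfun_apply h ((w \<circ> r) n)) \<longlonglongrightarrow> blinfun_apply h l"
    by (intro blinfun.tendsto tendsto_const lr(2))
  moreover have "(\<lambda>n. blinfun_apply h ((w \<circ> r) n)) \<longlonglongrightarrow> 1"
    using LIMSEQ_subseq_LIMSEQ[OF hw lr(1)] by (simp add: o_def)
  ultimately have hl: "blinfun_apply h l = 1" by (rule LIMSEQ_unique)
  have "norm l \<le> 1"
    using w1 by (intro Lim_bounded[OF tendsto_norm[OF lr(2)]]) auto
  moreover have "1 \<le> norm l" using norm_blinfun[of h l] h hl by simp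
  ultimately have nl: "norm l = 1" by simp
  then have "smooth_point l" using smooth unfolding smooth_space_def by force
  \<comment> \<open>At \<open>l\<close> the norm has derivative \<open>h (N l) = - 1\<close> in the
    direction \<open>N l\<close>; the error \<open>1/2\<close> still leaves a strict
    decrease.\<close>
  then obtain t where t: "0 < t" "norm (l + t *\<^sub>R blinfun_apply N l) < 1 + t * (blinfun_apply h (blinfun_apply N l) + 1/2)"
    using smooth_point_norm_derivative[OF _ h, of l "1/2" "blinfun_apply N l"] nl hl by auto
  then have lt1: "norm (l + t *\<^sub>R blinfun_apply N l) < 1" by (simp add: hN hl)
  have "(\<lambda>n. norm ((w \<circ> r) n + t *\<^sub>R blinfun_apply N ((w \<circ> r) n))) \<longlonglongrightarrow> norm (l + t *\<^sub>R blinfun_apply N l)"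
    by (intro tendsto_intros blinfun.tendsto lr(2))
  then have "eventually (\<lambda>n. norm ((w \<circ> r) n + t *\<^sub>R blinfun_apply N ((w \<circ> r) n)) < 1) sequentially"
    using lt1 by (rule order_tendstoD(2))
  moreover have "eventually (\<lambda>n. (s \<circ> r) n < t) sequentially"
    using LIMSEQ_subseq_LIMSEQ[OF s_lim lr(1)] t(1) by (rule order_tendstoD(2))
  ultimately obtain n where n: "norm ((w \<circ> r) n + t *\<^sub>R blinfun_apply N ((w \<circ> r) n)) < 1" "(s \<circ> r) n < t"
    using eventually_happens[OF eventually_conj] by force
  \<comment> \<open>Convexity carries the decrease from the step \<open>t\<close> to the smaller
    step \<open>s (r n)\<close>, against the choice of \<open>z\<close>.\<close>
  let ?s = "s (r n)" and ?w = "w (r n)"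
  have "norm (?w + ?s *\<^sub>R blinfun_apply N ?w) \<le> (1 - ?s / t) * norm ?w + (?s / t) * norm (?w + t *\<^sub>R blinfun_apply N ?w)"
    using n(2) s(1)[of "r n"] t(1) by (intro norm_segment_le) auto
  also have "\<dots> \<le> (1 - ?s / t) * 1 + (?s / t) * 1"
    using n s(1)[of "r n"] t(1) w1 by (intro add_mono mult_left_mono) auto
  finally show False using z(3)[of "r n"] by (simp add: w_def)
qed

section \<open>Failure of the uniform sBPBp\<close>

text \<open>The third hypothesis says that the dimension is at least two. On a line the norm one
  operators are plus and minus the identity and attain their norm at every unit vector, so there the
  property holds.\<close>

theorem theorem3p25:
  assumes "reflexive_space TYPE('a::banach)"
    and "smooth_space TYPE('a)"
    and "\<exists>B :: 'a set. independent B \<and> card B = 2"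
  shows "\<not> uniform_sBPBp (norm_one_smooth_compact_operators :: ('a \<Rightarrow>\<^sub>L 'a) set)"
proof
  assume bpb: "uniform_sBPBp (norm_one_smooth_compact_operators :: ('a \<Rightarrow>\<^sub>L 'a) set)"
  obtain T :: "'a \<Rightarrow>\<^sub>L 'a" and v and h :: "'a \<Rightarrow>\<^sub>L real" and N where T: "compact_operator T" "norm T = 1"
    and v: "v \<in> closure (blinfun_apply T ` cball 0 1)" "norm v = 1"
    and h: "norm h = 1" "blinfun_apply h v = 1"
    and N: "\<And>y. blinfun_apply h (blinfun_apply N y) = - blinfun_apply h y"
      "\<And>s. 0 < s \<Longrightarrow> s < 1/2 \<Longrightarrow> 1 < norm (T + s *\<^sub>R (N o\<^sub>L T))"
    using assms(3) ex_unstable_operator[OF assms(2)] by blast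
  let ?g = "\<lambda>y. blinfun_apply h (blinfun_apply T y)"
  obtain \<delta> where \<delta>: "0 < \<delta>"
    "\<And>\<eta>. 0 < \<eta> \<Longrightarrow> \<exists>y. norm y = 1 \<and> 1 - \<eta> < norm (blinfun_apply T y) \<and> \<bar>?g y\<bar> < 1 - \<delta>"
    using unstable_operator_second_maximiser[OF assms(2) T h(1) N] by blast
  obtain \<eta> where \<eta>: "0 < \<eta>" "\<And>S x. S \<in> (norm_one_smooth_compact_operators :: ('a \<Rightarrow>\<^sub>L 'a) set)
      \<Longrightarrow> norm x = 1 \<Longrightarrow> 1 - \<eta> < norm (blinfun_apply S x)
      \<Longrightarrow> \<exists>x1\<in>norm_attainment_set S. norm (x1 - x) < \<delta> / 2"
    using bpb \<delta>(1) unfolding uniform_sBPBp_def by (metis half_gt_zero mem_sphere_0)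
  obtain y where y: "norm y = 1" "1 - \<eta> / 4 < norm (blinfun_apply T y)" "\<bar>?g y\<bar> < 1 - \<delta>"
    using \<delta>(2)[of "\<eta> / 4"] \<eta>(1) by auto
  have \<delta>1: "\<delta> < 1" using y(3) by linarith
  \<comment> \<open>\<open>\<tau>\<close> is small enough for \<open>y\<close> to remain an
    \<open>\<eta>\<close>-near-maximiser after perturbing and normalising. \<open>\<rho>\<close> is
    small relative to \<open>\<tau>\<close>, since \<open>2 * \<rho> / \<tau> = \<delta> / 4\<close>
    is the error allowed in \<open>h (T x)\<close>.\<close>
  define \<tau> where "\<tau> = \<eta> / 8"
  define \<rho> where "\<rho> = \<tau> * \<delta> / 8"
  have \<tau>: "0 < \<tau>" using \<eta>(1) by (simp add: \<tau>_def)
  have \<rho>: "0 < \<rho>" "\<rho> \<le> \<tau> / 8" using \<tau> \<delta>(1) \<delta>1 by (simp_all add: \<rho>_def)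
  define T' where "T' = T + \<tau> *\<^sub>R rank_one (h o\<^sub>L T) v"
  have T'_apply: "blinfun_apply T' z = blinfun_apply T z + (\<tau> * ?g z) *\<^sub>R v" for z
    by (simp add: T'_def blinfun.bilinear_simps)
  have g_le: "\<bar>?g z\<bar> \<le> norm z" for z
    using norm_blinfun[of h "blinfun_apply T z"] norm_blinfun[of T z] h(1) T(2) by simp
  have T'_near: "norm (blinfun_apply T' z - blinfun_apply T z) \<le> \<tau> * \<bar>?g z\<bar>" for z
    using \<tau> v(2) by (simp add: T'_apply abs_mult)
  have T'_ge: "1 + \<tau> \<le> norm T'"
  proof -
    \<comment> \<open>\<open>v\<close> is only a limit of images of the unit ball, so the estimate
      is proved on the images and passed to their closure.\<close>
    have "closure (blinfun_apply T ` cball 0 1) \<subseteq> {y. norm (y + (\<tau> * blinfun_apply h y) *\<^sub>R v) \<le> norm T'}"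
    proof (rule closure_minimal)
      show "blinfun_apply T ` cball 0 1 \<subseteq> {y. norm (y + (\<tau> * blinfun_apply h y) *\<^sub>R v) \<le> norm T'}"
        using norm_blinfun_apply_le[of _ T'] by (auto simp: T'_apply)
      show "closed {y. norm (y + (\<tau> * blinfun_apply h y) *\<^sub>R v) \<le> norm T'}"
        by (intro closed_Collect_le continuous_intros)
    qed
    then have "norm (v + (\<tau> * blinfun_apply h v) *\<^sub>R v) \<le> norm T'" using v(1) by blast
    moreover have "v + (\<tau> * blinfun_apply h v) *\<^sub>R v = (1 + \<tau>) *\<^sub>R v"
      by (simp add: h(2) scaleR_add_left)
    ultimately show ?thesis using v(2) \<tau> by simp
  qed
  have T'_le: "norm T' \<le> 1 + \<tau>"
  proof (rule norm_blinfun_le_cball)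
    fix z :: 'a assume z: "norm z \<le> 1"
    have "\<tau> * \<bar>?g z\<bar> \<le> \<tau> * 1" using \<tau> g_le[of z] z by (intro mult_left_mono) auto
    then show "norm (blinfun_apply T' z) \<le> 1 + \<tau>"
      using T'_near[of z] norm_triangle_sub[of "blinfun_apply T' z" "blinfun_apply T z"]
        norm_blinfun_apply_le[OF z, of T] T(2) by linarith
  qed
  have "compact_operator T'"
    unfolding T'_def by (intro compact_operator_add compact_operator_scaleR compact_operator_rank_one T(1))
  moreover have "T' \<noteq> 0" using T'_ge \<tau> by auto
  ultimately obtain B where B: "norm B < \<rho>" "T' + B \<noteq> 0"
    "inverse (norm (T' + B)) *\<^sub>R (T' + B) \<in> norm_one_smooth_compact_operators"
    using smooth_operator_perturbation[OF assms(1,2)] \<rho>(1) by blast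
  define A where "A = T' + B"
  have A_near: "norm (blinfun_apply A z - blinfun_apply T' z) \<le> \<rho>" if "norm z = 1" for z
    using norm_blinfun_apply_le[of z B] that B(1) by (simp add: A_def blinfun.add_left)
  have A_bounds: "1 + \<tau> - \<rho> \<le> norm A" "norm A \<le> 1 + \<tau> + \<rho>"
    using norm_triangle_ineq[of T' B] norm_diff_ineq[of T' B] B(1) T'_ge T'_le unfolding A_def by linarith+
  have A0: "0 < norm A" using B(2) by (simp add: A_def)
  have scaled: "norm (blinfun_apply (inverse (norm A) *\<^sub>R A) z) = norm (blinfun_apply A z) / norm A" for z
    by (simp add: blinfun.scaleR_left divide_inverse mult.commute)
  have "1 - \<eta> < norm (blinfun_apply (inverse (norm A) *\<^sub>R A) y)"
  proof -
    have "\<tau> * \<bar>?g y\<bar> \<le> \<tau> * 1" using \<tau> g_le[of y] y(1) by (intro mult_left_mono) auto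
    then have "norm (blinfun_apply T y) - \<tau> - \<rho> \<le> norm (blinfun_apply A y)"
      using T'_near[of y] A_near[OF y(1)]
        norm_triangle_ineq2[of "blinfun_apply T y" "blinfun_apply T' y"]
        norm_triangle_ineq2[of "blinfun_apply T' y" "blinfun_apply A y"]
      by (simp add: norm_minus_commute)
    moreover have "\<eta> * 1 \<le> \<eta> * norm A" using \<eta>(1) A_bounds(1) \<rho> \<tau> by (intro mult_left_mono) auto
    ultimately have "norm A - \<eta> * norm A < norm (blinfun_apply A y)"
      using A_bounds(2) y(2) \<rho> \<tau> unfolding \<tau>_def by linarith
    then show ?thesis unfolding scaled using A0 by (simp add: field_simps)
  qed
  then obtain x where x: "x \<in> norm_attainment_set (inverse (norm A) *\<^sub>R A)" "norm (x - y) < \<delta> / 2"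
    using \<eta>(2)[OF B(3) y(1)] unfolding A_def by blast
  have x1: "norm x = 1" "norm (blinfun_apply A x) = norm A"
    using x(1) A0 unfolding norm_attainment_set_def mem_Collect_eq scaled by auto
  \<comment> \<open>Compared with \<open>norm A \<ge> 1 + \<tau> - \<rho>\<close>, this makes every
    maximiser \<open>x\<close> nearly maximal for the absolute value of
    \<open>h (T x)\<close>.\<close>
  have "norm A \<le> 1 + \<tau> * \<bar>?g x\<bar> + \<rho>"
    using x1(2) A_near[OF x1(1)] T'_near[of x] norm_blinfun_apply_le[of x T] x1(1) T(2)
      norm_triangle_sub[of "blinfun_apply A x" "blinfun_apply T' x"]
      norm_triangle_sub[of "blinfun_apply T' x" "blinfun_apply T x"] by linarith
  then have "\<tau> * (1 - \<delta> / 4) \<le> \<tau> * \<bar>?g x\<bar>"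
    using A_bounds(1) by (simp add: \<rho>_def right_diff_distrib)
  then have "1 - \<delta> / 4 \<le> \<bar>?g x\<bar>" using \<tau> by (rule mult_left_le_imp_le)
  \<comment> \<open>\<open>h\<close> composed with \<open>T\<close> is 1-Lipschitz, so a point
    within \<open>\<delta> / 2\<close> of \<open>y\<close> has a value of modulus below
    \<open>1 - \<delta> / 2\<close>.\<close>
  moreover have "?g x = ?g y + ?g (x - y)" by (simp add: blinfun.diff_right)
  ultimately show False using g_le[of "x - y"] x(2) y(3) \<delta>(1) by linarith
qed

end
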